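(* For every knot $K$, $(\kappa+\tau)[K] \le 2\pi\, sp[K]$.
   Context: $[K]$ denotes the isotopy class (knot type) of a knot in $\mathbb{R}^3$; a conformation is a smooth simple closed curve representing it. A smooth projection is the orthogonal projection of a conformation to a plane, assumed to be an immersed closed curve with finitely many crossings, all transverse double points. An inflection point of the projection is a point where the planar curvature vanishes (assumed isolated); it is an $s$-inflection point if the signed planar curvature changes sign there. The projection is in spiral form if it has no $s$-inflection points. A projection in spiral form has the same number of local maxima with respect to every direction in the plane; this number is its spiral number $sp(P(K))$. The spiral index $sp[K]$ is the minimum of $sp(P(K))$ over all spiral-form projections of all conformations of $K$. Milnor's curvature-torsion invariant is $(\kappa+\tau)[K] = \inf_{K\in[K]} \int_K (\kappa+|\tau|)\,ds$, the infimum being over smooth conformations with nowhere vanishing curvature (so that the torsion $\tau$ is defined), where $\kappa$ is curvature and $s$ is arc length. *)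

theory Defs
  imports "HOL-Analysis.Analysis"
begin

definition vderiv :: "(real \<Rightarrow> 'a::real_normed_vector) \<Rightarrow> real \<Rightarrow> 'a" where
  "vderiv f t = vector_derivative f (at t)"

definition smooth_curve :: "(real \<Rightarrow> 'a::real_normed_vector) \<Rightarrow> bool" where
  "smooth_curve f \<longleftrightarrow> (\<forall>n t. (vderiv ^^ n) f differentiable (at t))"

text \<open>A closed curve is a 1-periodic map on the real line, so that smoothness at the closing
  point is included; one traversal of it is \<open>{0..<1}\<close>. The parametrisation need not be by
  arc length.\<close>

definition smooth_immersed_closed_curve :: "(real \<Rightarrow> 'a::real_normed_vector) \<Rightarrow> bool" where
  "smooth_immersed_closed_curve f \<longleftrightarrow>
     smooth_curve f \<and> (\<forall>t. f (t + 1) = f t) \<and> (\<forall>t. vderiv f t \<noteq> 0)"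

definition smooth_simple_closed_curve :: "(real \<Rightarrow> 'a::real_normed_vector) \<Rightarrow> bool" where
  "smooth_simple_closed_curve f \<longleftrightarrow> smooth_immersed_closed_curve f \<and> inj_on f {0..<1}"

definition ambient_isotopic :: "(real^3) set \<Rightarrow> (real^3) set \<Rightarrow> bool" where
  "ambient_isotopic A B \<longleftrightarrow>
     (\<exists>h :: real \<Rightarrow> real^3 \<Rightarrow> real^3.
        continuous_on ({0..1} \<times> UNIV) (\<lambda>(t, x). h t x) \<and>
        (\<forall>t\<in>{0..1}. \<exists>g. homeomorphism UNIV UNIV (h t) g) \<and>
        h 0 = id \<and> h 1 ` A = B)"

definition knot :: "(real^3) set \<Rightarrow> bool" where
  "knot K \<longleftrightarrow> (\<exists>\<gamma>. smooth_simple_closed_curve \<gamma> \<and> K = range \<gamma>)"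

definition conformation :: "(real \<Rightarrow> real^3) \<Rightarrow> (real^3) set \<Rightarrow> bool" where
  "conformation \<gamma> K \<longleftrightarrow> smooth_simple_closed_curve \<gamma> \<and> ambient_isotopic K (range \<gamma>)"

text \<open>\<open>arc_deriv c f\<close> is \<open>df/ds\<close>, where \<open>s\<close> is the arc length of \<open>c\<close>. The definitions below are
  the Frenet equations for a regular, arbitrarily parametrised curve.\<close>

definition arc_deriv ::
    "(real \<Rightarrow> 'b::real_normed_vector) \<Rightarrow> (real \<Rightarrow> 'a::real_normed_vector) \<Rightarrow> real \<Rightarrow> 'a" where
  "arc_deriv c f t = vderiv f t /\<^sub>R norm (vderiv c t)"

definition unit_tangent :: "(real \<Rightarrow> 'a::real_normed_vector) \<Rightarrow> real \<Rightarrow> 'a" where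
  "unit_tangent c t = sgn (vderiv c t)"

definition curvature :: "(real \<Rightarrow> real^3) \<Rightarrow> real \<Rightarrow> real" where
  "curvature c t = norm (arc_deriv c (unit_tangent c) t)"

definition principal_normal :: "(real \<Rightarrow> real^3) \<Rightarrow> real \<Rightarrow> real^3" where
  "principal_normal c t = sgn (arc_deriv c (unit_tangent c) t)"

definition binormal :: "(real \<Rightarrow> real^3) \<Rightarrow> real \<Rightarrow> real^3" where
  "binormal c t = cross3 (unit_tangent c t) (principal_normal c t)"

definition torsion :: "(real \<Rightarrow> real^3) \<Rightarrow> real \<Rightarrow> real" where
  "torsion c t = - (arc_deriv c (binormal c) t \<bullet> principal_normal c t)"

definition total_curvature_torsion :: "(real \<Rightarrow> real^3) \<Rightarrow> real" where
  "total_curvature_torsion c =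
     integral {0..1} (\<lambda>t. (curvature c t + \<bar>torsion c t\<bar>) * norm (vderiv c t))"

text \<open>The infimum is taken in the extended reals, so that no non-emptiness is presupposed.\<close>

definition kappa_tau :: "(real^3) set \<Rightarrow> ereal" where
  "kappa_tau K =
     Inf {ereal (total_curvature_torsion \<gamma>) | \<gamma>. conformation \<gamma> K \<and> (\<forall>t. curvature \<gamma> t \<noteq> 0)}"

text \<open>The plane spanned by the orthonormal pair \<open>u\<close>, \<open>v\<close> is identified with \<open>real^2\<close> through the
  coordinates given by \<open>u\<close> and \<open>v\<close>. Parallel planes give the same projection up to translation.\<close>

definition plane_projection :: "real^3 \<Rightarrow> real^3 \<Rightarrow> (real \<Rightarrow> real^3) \<Rightarrow> real \<Rightarrow> real^2" where
  "plane_projection u v \<gamma> t = vector [\<gamma> t \<bullet> u, \<gamma> t \<bullet> v]"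

definition rot90 :: "real^2 \<Rightarrow> real^2" where
  "rot90 x = vector [- x $ 2, x $ 1]"

text \<open>The planar Frenet equation \<open>dT/ds = k (rot90 T)\<close>, solved for the signed curvature \<open>k\<close>.\<close>

definition signed_curvature :: "(real \<Rightarrow> real^2) \<Rightarrow> real \<Rightarrow> real" where
  "signed_curvature p t = arc_deriv p (unit_tangent p) t \<bullet> rot90 (unit_tangent p t)"

definition crossings :: "(real \<Rightarrow> real^2) \<Rightarrow> (real^2) set" where
  "crossings p = {x. \<exists>s\<in>{0..<1}. \<exists>t\<in>{0..<1}. s \<noteq> t \<and> p s = x \<and> p t = x}"

text \<open>Inflection points are identified by their parameter.\<close>

definition inflection :: "(real \<Rightarrow> real^2) \<Rightarrow> real \<Rightarrow> bool" where
  "inflection p t \<longleftrightarrow> signed_curvature p t = 0"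

definition s_inflection :: "(real \<Rightarrow> real^2) \<Rightarrow> real \<Rightarrow> bool" where
  "s_inflection p t \<longleftrightarrow> inflection p t \<and>
     ((\<forall>\<^sub>F s in at_left t. signed_curvature p s < 0) \<and>
      (\<forall>\<^sub>F s in at_right t. signed_curvature p s > 0) \<or>
      (\<forall>\<^sub>F s in at_left t. signed_curvature p s > 0) \<and>
      (\<forall>\<^sub>F s in at_right t. signed_curvature p s < 0))"

definition regular_diagram :: "(real \<Rightarrow> real^2) \<Rightarrow> bool" where
  "regular_diagram p \<longleftrightarrow>
     smooth_immersed_closed_curve p \<and>
     finite (crossings p) \<and>
     (\<forall>x\<in>crossings p. card {t\<in>{0..<1}. p t = x} = 2) \<and>
     (\<forall>s\<in>{0..<1}. \<forall>t\<in>{0..<1}. s \<noteq> t \<and> p s = p t \<longrightarrow>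
        \<not> collinear {0, vderiv p s, vderiv p t}) \<and>
     (\<forall>t. inflection p t \<longrightarrow> (\<forall>\<^sub>F s in at t. \<not> inflection p s))"

definition smooth_projection :: "(real \<Rightarrow> real^2) \<Rightarrow> (real \<Rightarrow> real^3) \<Rightarrow> bool" where
  "smooth_projection p \<gamma> \<longleftrightarrow>
     (\<exists>u v. norm u = 1 \<and> norm v = 1 \<and> u \<bullet> v = 0 \<and> p = plane_projection u v \<gamma>) \<and>
     regular_diagram p"

definition spiral_form :: "(real \<Rightarrow> real^2) \<Rightarrow> bool" where
  "spiral_form p \<longleftrightarrow> (\<forall>t. \<not> s_inflection p t)"

definition num_local_maxima :: "(real \<Rightarrow> real^2) \<Rightarrow> real^2 \<Rightarrow> nat" where
  "num_local_maxima p d = card {t\<in>{0..<1}. \<forall>\<^sub>F s in at t. p s \<bullet> d \<le> p t \<bullet> d}"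

definition spiral_number :: "(real \<Rightarrow> real^2) \<Rightarrow> nat" where
  "spiral_number p = (THE n. \<forall>d. norm d = 1 \<longrightarrow> num_local_maxima p d = n)"

text \<open>An infimum of a non-empty set of extended naturals is a minimum; the infimum of the empty set
  would be infinity.\<close>

definition spiral_index :: "(real^3) set \<Rightarrow> enat" where
  "spiral_index K =
     Inf {enat (spiral_number p) | p \<gamma>.
            conformation \<gamma> K \<and> smooth_projection p \<gamma> \<and> spiral_form p}"

end

theory Submission
  imports Defs "HOL-Library.Periodic_Fun"
begin

text \<open>Let \<open>w\<close> be a unit normal of the plane of a spiral projection \<open>p\<close> of \<open>\<gamma>\<close>. Squashing \<open>\<gamma>\<close> towards the
  plane by a factor \<open>e\<close> is an ambient isotopy, and as \<open>e \<rightarrow> 0\<close> the total curvature tends to that of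
  \<open>p\<close>, which is \<open>2\<pi>\<close> times the spiral number because the tangent angle of \<open>p\<close> is strictly monotone.
  The torsion tends to \<open>0\<close> in the mean, but only where the curvature of \<open>p\<close> does not vanish.
  The finitely many inflection points are therefore removed first, by adding to \<open>\<gamma>\<close> a small multiple
  of \<open>q = f \<cdot> (w \<times> \<gamma>')\<close>, where \<open>f\<close> vanishes to exactly second order at them: to first order this raises
  the planar curvature there. The knot type survives because \<open>q \<circ> \<gamma>\<inverse>\<close> is Lipschitz on the curve, hence
  extends to a Lipschitz map \<open>F\<close> of space, and \<open>x + d F x\<close> is a homeomorphism for small \<open>d\<close>.\<close>

section \<open>Smooth curves\<close>

text \<open>Squashing by \<open>e\<close> has determinant \<open>e\<close>, so it multiplies the
  numerator det(\<gamma>', \<gamma>'', \<gamma>''') of the torsion density by \<open>e\<close>. The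
  denominator is a power of |\<gamma>' \<times> \<gamma>''|, for which the planar determinant of the
  projection is the lower bound uniform in \<open>e\<close>; at an inflection point this bound is
  void. That dictates the order of the limits. For a fixed perturbation size \<open>d > 0\<close>
  the planar determinant is positive and \<open>e\<close> goes to 0, which removes the torsion. What
  remains has the planar determinant in the numerator only, so \<open>d\<close> can then go to 0
  although the inflection points come back. As \<open>kappa_tau\<close> is an infimum, each limit
  only has to carry an upper bound along. The first-order change of the planar determinant is a
  combination of f, f' and f''. The terms with f and f' have no controlled sign, while the
  coefficient of f'' is the squared speed of the projection; this is why f and f' vanish at the
  inflection points and f'' is positive there.\<close>

lemma smooth_curve_has_vector_derivative:
  "smooth_curve f \<Longrightarrow> (f has_vector_derivative vderiv f t) (at t)"
  unfolding smooth_curve_def vderiv_def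
  by (metis funpow_0 vector_derivative_works)

lemma smooth_curve_vderiv: "smooth_curve f \<Longrightarrow> smooth_curve (vderiv f)"
  unfolding smooth_curve_def by (metis comp_apply funpow_Suc_right)

lemma vderiv_eqI: "(\<And>t. (f has_vector_derivative f' t) (at t)) \<Longrightarrow> vderiv f = f'"
  unfolding vderiv_def by (intro ext vector_derivative_at)

lemma smooth_curve_continuous: "smooth_curve f \<Longrightarrow> continuous_on A f"
  using smooth_curve_has_vector_derivative has_vector_derivative_continuous
  by (metis continuous_at_imp_continuous_on)

text \<open>Smoothness speaks of all iterates of \<open>vderiv\<close>. A class of curves in which
  every member has a derivative in the class contains all these iterates, so closure properties
  reduce to naming a class stable under one differentiation.\<close>

lemma smooth_curve_coinduct:
  assumes "P f"
    and step: "\<And>g. P g \<Longrightarrow> \<exists>g'. P g' \<and> (\<forall>t. (g has_vector_derivative g' t) (at t))"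
  shows "smooth_curve f"
proof -
  have *: "P (vderiv g) \<and> (\<forall>t. g differentiable (at t))" if "P g" for g
    using step[OF that] vderiv_eqI differentiableI_vector by metis
  have "P ((vderiv ^^ n) f)" for n
    by (induction n) (use assms(1) * in auto)
  then show ?thesis unfolding smooth_curve_def using * by blast
qed

lemma smooth_curve_add:
  assumes "smooth_curve f" "smooth_curve g"
  shows "smooth_curve (\<lambda>t. f t + g t)"
proof (rule smooth_curve_coinduct[where P = "\<lambda>h. \<exists>f g. smooth_curve f \<and> smooth_curve g \<and> h = (\<lambda>t. f t + g t)"])
  fix h :: "real \<Rightarrow> 'a" assume "\<exists>f g. smooth_curve f \<and> smooth_curve g \<and> h = (\<lambda>t. f t + g t)"
  then obtain f g where "smooth_curve f" "smooth_curve g" "h = (\<lambda>t. f t + g t)" by blast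
  then show "\<exists>h'. (\<exists>f g. smooth_curve f \<and> smooth_curve g \<and> h' = (\<lambda>t. f t + g t)) \<and>
      (\<forall>t. (h has_vector_derivative h' t) (at t))"
    by (intro exI[of _ "\<lambda>t. vderiv f t + vderiv g t"])
      (auto intro!: has_vector_derivative_add smooth_curve_has_vector_derivative
        intro: smooth_curve_vderiv)
qed (use assms in blast)

lemma smooth_curve_bounded_linear:
  assumes "bounded_linear L" "smooth_curve f"
  shows "smooth_curve (\<lambda>t. L (f t))"
proof (rule smooth_curve_coinduct[where P = "\<lambda>h. \<exists>f. smooth_curve f \<and> h = (\<lambda>t. L (f t))"])
  fix h assume "\<exists>f. smooth_curve f \<and> h = (\<lambda>t. L (f t))"
  then obtain f where "smooth_curve f" "h = (\<lambda>t. L (f t))" by blast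
  then show "\<exists>h'. (\<exists>f. smooth_curve f \<and> h' = (\<lambda>t. L (f t))) \<and>
      (\<forall>t. (h has_vector_derivative h' t) (at t))"
    by (intro exI[of _ "\<lambda>t. L (vderiv f t)"])
      (auto intro!: bounded_linear.has_vector_derivative[OF assms(1)]
         smooth_curve_has_vector_derivative intro: smooth_curve_vderiv)
qed (use assms in blast)

text \<open>Unlike the products themselves, their finite sums are closed under derivatives.\<close>

inductive scaleR_sum :: "(real \<Rightarrow> 'a::real_normed_vector) \<Rightarrow> bool" where
  "smooth_curve f \<Longrightarrow> smooth_curve g \<Longrightarrow> scaleR_sum (\<lambda>t. f t *\<^sub>R g t)"
| "scaleR_sum g \<Longrightarrow> scaleR_sum h \<Longrightarrow> scaleR_sum (\<lambda>t. g t + h t)"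

lemma smooth_curve_scaleR:
  assumes "smooth_curve f" "smooth_curve g"
  shows "smooth_curve (\<lambda>t. f t *\<^sub>R g t)"
proof (rule smooth_curve_coinduct[where P = scaleR_sum])
  fix h :: "real \<Rightarrow> 'a" assume "scaleR_sum h"
  then show "\<exists>h'. scaleR_sum h' \<and> (\<forall>t. (h has_vector_derivative h' t) (at t))"
  proof induction
    case (1 f g)
    have "scaleR_sum (\<lambda>t. f t *\<^sub>R vderiv g t + vderiv f t *\<^sub>R g t)"
      using 1 by (intro scaleR_sum.intros smooth_curve_vderiv)
    moreover have "((\<lambda>t. f t *\<^sub>R g t) has_vector_derivative f t *\<^sub>R vderiv g t + vderiv f t *\<^sub>R g t) (at t)" for t
      using has_vector_derivative_scaleR[of f "vderiv f t" t UNIV g "vderiv g t"]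
        1[THEN smooth_curve_has_vector_derivative]
      by (simp add: has_real_derivative_iff_has_vector_derivative)
    ultimately show ?case by blast
  next
    case (2 g h)
    then obtain g' h' where "scaleR_sum g'" "\<And>t. (g has_vector_derivative g' t) (at t)"
      "scaleR_sum h'" "\<And>t. (h has_vector_derivative h' t) (at t)" by blast
    then show ?case
      by (intro exI[of _ "\<lambda>t. g' t + h' t"] conjI allI scaleR_sum.intros has_vector_derivative_add)
  qed
qed (use assms in \<open>rule scaleR_sum.intros\<close>)

lemma smooth_curve_const: "smooth_curve (\<lambda>t. c)"
  by (rule smooth_curve_coinduct[where P = "\<lambda>f. \<exists>c. f = (\<lambda>t. c)"])
    (auto intro!: exI[of _ "\<lambda>t. 0"] derivative_eq_intros)

lemma smooth_curve_cos_shift: "smooth_curve (\<lambda>t. cos (k * t + c))"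
proof (rule smooth_curve_coinduct[where P = "\<lambda>f. \<exists>a b. f = (\<lambda>t. a * cos (k * t + c) + b * sin (k * t + c))"])
  fix g assume "\<exists>a b. g = (\<lambda>t. a * cos (k * t + c) + b * sin (k * t + c))"
  then obtain a b where g: "g = (\<lambda>t. a * cos (k * t + c) + b * sin (k * t + c))" by blast
  show "\<exists>g'. (\<exists>a b. g' = (\<lambda>t. a * cos (k * t + c) + b * sin (k * t + c))) \<and>
       (\<forall>t. (g has_vector_derivative g' t) (at t))"
    unfolding g has_real_derivative_iff_has_vector_derivative[symmetric]
    by (intro exI[of _ "\<lambda>t. (b*k) * cos (k * t + c) + (-a*k) * sin (k * t + c)"] conjI exI allI)
      (rule refl | (auto intro!: derivative_eq_intros simp: algebra_simps))+
qed (rule exI[of _ 1], rule exI[of _ 0], simp)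

section \<open>Ambient isotopy of small perturbations\<close>

lemma periodic_frac:
  fixes f :: "real \<Rightarrow> 'a"
  assumes "\<And>t. f (t + 1) = f t"
  shows "f (frac t) = f t"
proof -
  interpret periodic_fun_simple' f by unfold_locales (rule assms)
  show ?thesis unfolding frac_def by (rule minus_of_int)
qed

lemma has_vector_derivative_affine:
  assumes "(f has_vector_derivative f') (at (s + x * h))"
  shows "((\<lambda>x. f (s + x * h)) has_vector_derivative h *\<^sub>R f') (at x)"
proof -
  have "((\<lambda>x. s + x * h) has_vector_derivative h) (at x)"
    by (auto intro!: derivative_eq_intros)
  from vector_diff_chain_at[OF this assms] show ?thesis by (simp add: o_def)
qed

lemma periodic_vderiv:
  assumes "smooth_curve f" "\<And>t. f (t + 1) = f t"
  shows "vderiv f (t + 1) = vderiv f t"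
proof -
  have "((\<lambda>t. f (t + 1)) has_vector_derivative vderiv f (t + 1)) (at t)"
    using has_vector_derivative_affine[of f "vderiv f (t + 1)" 1 t 1]
      smooth_curve_has_vector_derivative[OF assms(1), of "t + 1"]
    by (simp add: add.commute)
  then show ?thesis
    using smooth_curve_has_vector_derivative[OF assms(1), of t] assms(2)
    by (simp add: vector_derivative_unique_at)
qed

lemma periodic_continuous_bounded:
  fixes f :: "real \<Rightarrow> 'a::real_normed_vector"
  assumes "\<And>t. f (t + 1) = f t" "continuous_on UNIV f"
  obtains B where "B > 0" "\<And>t. norm (f t) \<le> B"
proof -
  have "bounded (f ` {0..1})"
    using assms(2) by (intro compact_imp_bounded compact_continuous_image) (auto intro: continuous_on_subset)
  then obtain B where B: "B > 0" "\<And>t. t \<in> {0..1} \<Longrightarrow> norm (f t) \<le> B"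
    unfolding bounded_pos by auto
  show ?thesis
  proof (rule that[OF B(1)])
    fix t :: real
    have "frac t \<in> {0..1}" using frac_ge_0[of t] frac_lt_1[of t] by auto
    then show "norm (f t) \<le> B" using B(2)[of "frac t"] periodic_frac[of f t] assms(1) by simp
  qed
qed

text \<open>The difference quotient extends continuously to h = 0. It is nonzero there because the
  curve is immersed, and nonzero for other h because the curve is simple; compactness gives a
  positive minimum. Offsets up to 1/2 suffice to join any two parameters modulo 1.\<close>

lemma chord_arc:
  fixes \<gamma> :: "real \<Rightarrow> 'a::euclidean_space"
  assumes "smooth_simple_closed_curve \<gamma>"
  obtains c where "c > 0" "\<And>s h. \<bar>h\<bar> \<le> 1/2 \<Longrightarrow> c * \<bar>h\<bar> \<le> norm (\<gamma> (s + h) - \<gamma> s)"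
proof -
  have sm: "smooth_curve \<gamma>" and per: "\<And>t. \<gamma> (t + 1) = \<gamma> t" and nz: "\<And>t. vderiv \<gamma> t \<noteq> 0"
    and inj: "inj_on \<gamma> {0..<1}"
    using assms by (auto simp: smooth_simple_closed_curve_def smooth_immersed_closed_curve_def)
  text \<open>The difference quotient of \<open>\<gamma>\<close>, extended continuously to \<open>h = 0\<close>.\<close>
  define \<Phi> where "\<Phi> = (\<lambda>z. integral (cbox 0 1) (\<lambda>x. vderiv \<gamma> (fst z + x * snd z)))"
  have diff: "\<gamma> (s + h) - \<gamma> s = h *\<^sub>R \<Phi> (s, h)" for s h
  proof -
    have "((\<lambda>x. \<gamma> (s + x * h)) has_vector_derivative h *\<^sub>R vderiv \<gamma> (s + x * h)) (at x)" for x
      by (intro has_vector_derivative_affine smooth_curve_has_vector_derivative sm)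
    then have "((\<lambda>x. h *\<^sub>R vderiv \<gamma> (s + x * h)) has_integral (\<gamma> (s + 1 * h) - \<gamma> (s + 0 * h))) {0..1}"
      by (intro fundamental_theorem_of_calculus) (auto intro: has_vector_derivative_at_within)
    from integral_unique[OF this] show ?thesis unfolding \<Phi>_def by simp
  qed
  have "continuous_on UNIV (vderiv \<gamma>)"
    by (intro smooth_curve_continuous smooth_curve_vderiv sm)
  then have "continuous_on UNIV \<Phi>"
    unfolding \<Phi>_def
    by (intro integral_continuous_on_param)
      (auto simp: split_beta intro!: continuous_intros intro: continuous_on_compose2)
  have \<Phi>nz: "\<Phi> (s, h) \<noteq> 0" if "\<bar>h\<bar> \<le> 1/2" for s h
  proof (cases "h = 0")
    case True
    then show ?thesis unfolding \<Phi>_def using nz by simp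
  next
    case False
    have "frac s \<noteq> frac (s + h)"
    proof
      assume "frac s = frac (s + h)"
      then have "h = of_int (\<lfloor>s + h\<rfloor> - \<lfloor>s\<rfloor>)" by (simp add: frac_def)
      then obtain m :: int where m: "h = m" by blast
      then have "m = 0" using that by linarith
      then show False using False m by simp
    qed
    then have "\<gamma> (frac s) \<noteq> \<gamma> (frac (s + h))"
      using inj by (auto simp: inj_on_def frac_lt_1)
    then have "\<gamma> (s + h) - \<gamma> s \<noteq> 0" by (simp add: periodic_frac[of \<gamma>, OF per])
    then show ?thesis using diff[of s h] by auto
  qed
  have "\<exists>z\<in>{0..1} \<times> {-1/2..1/2}. \<forall>y\<in>{0..1} \<times> {-1/2..1/2}. norm (\<Phi> z) \<le> norm (\<Phi> y)"
    using \<open>continuous_on UNIV \<Phi>\<close>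
    by (intro continuous_attains_inf compact_Times) (auto intro!: continuous_intros intro: continuous_on_subset)
  then obtain z where z: "z \<in> {0..1} \<times> {-1/2..1/2}"
    "\<And>y. y \<in> {0..1} \<times> {-1/2..1/2} \<Longrightarrow> norm (\<Phi> z) \<le> norm (\<Phi> y)" by blast
  show ?thesis
  proof (rule that[of "norm (\<Phi> z)"])
    have "\<bar>snd z\<bar> \<le> 1/2" using z(1) by (cases z) (auto simp: abs_le_iff)
    then show "norm (\<Phi> z) > 0" using \<Phi>nz[of "snd z" "fst z"] by simp
    fix s h :: real assume h: "\<bar>h\<bar> \<le> 1/2"
    \<comment> \<open>The minimum was taken over base points in one period; a general s is moved
      there with the offset h unchanged.\<close>
    interpret periodic_fun_simple' \<gamma> by unfold_locales (rule per)
    have "\<gamma> (frac s + h) = \<gamma> (s + h)"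
      using minus_of_int[of "s + h" "\<lfloor>s\<rfloor>"] by (simp add: frac_def algebra_simps)
    then have "\<gamma> (s + h) - \<gamma> s = h *\<^sub>R \<Phi> (frac s, h)"
      using diff[of "frac s" h] periodic_frac[of \<gamma>, OF per, of s] by simp
    moreover have "norm (\<Phi> z) \<le> norm (\<Phi> (frac s, h))"
    proof (rule z(2))
      show "(frac s, h) \<in> {0..1} \<times> {-1/2..1/2}"
        using h frac_ge_0[of s] frac_lt_1[of s] by (auto simp: abs_le_iff)
    qed
    ultimately show "norm (\<Phi> z) * \<bar>h\<bar> \<le> norm (\<gamma> (s + h) - \<gamma> s)"
      by (simp add: mult.commute mult_left_mono)
  qed
qed

section \<open>Lipschitz extension and homeomorphisms close to the identity\<close>

text \<open>This is McShane's extension: the lower envelope of the cones of slope L erected over the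
  graph of f.\<close>

lemma lipschitz_extension_real:
  fixes f :: "'a::metric_space \<Rightarrow> real"
  assumes "L-lipschitz_on S f"
  obtains g where "L-lipschitz_on UNIV g" "\<And>x. x \<in> S \<Longrightarrow> g x = f x"
proof (cases "S = {}")
  case True
  then show ?thesis
    using that[of "\<lambda>_. 0"] lipschitz_on_nonneg[OF assms] by (simp add: lipschitz_on_def)
next
  case False
  have L: "L \<ge> 0" and lip: "\<And>x y. x \<in> S \<Longrightarrow> y \<in> S \<Longrightarrow> \<bar>f x - f y\<bar> \<le> L * dist x y"
    using assms by (auto simp: lipschitz_on_def dist_real_def)
  define g where "g = (\<lambda>x. INF y\<in>S. f y + L * dist x y)"
  \<comment> \<open>One fixed z bounds all cones from below, so the infimum in \<open>g\<close> is
    genuine; for x = z in S the same inequality shows that no cone dips below f x.\<close>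
  have lower: "f z - L * dist x z \<le> f y + L * dist x y" if "z \<in> S" "y \<in> S" for x y z
  proof -
    have "f z - f y \<le> L * dist z y" using lip[OF that] by simp
    also have "\<dots> \<le> L * (dist x z + dist x y)"
      using L by (intro mult_left_mono) (metis dist_triangle3 dist_commute add.commute)
    finally show ?thesis by (simp add: algebra_simps)
  qed
  have bdd: "bdd_below ((\<lambda>y. f y + L * dist x y) ` S)" for x
    using lower False unfolding bdd_below_def by blast
  have "g x \<le> g x' + L * dist x x'" for x x'
  proof -
    have "g x - L * dist x x' \<le> f y + L * dist x' y" if "y \<in> S" for y
    proof -
      have "g x \<le> f y + L * dist x y" unfolding g_def using bdd that by (rule cINF_lower)
      also have "\<dots> \<le> f y + L * (dist x x' + dist x' y)"
        using L by (intro add_left_mono mult_left_mono dist_triangle)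
      finally show ?thesis by (simp add: algebra_simps)
    qed
    then have "g x - L * dist x x' \<le> g x'"
      unfolding g_def using False by (intro cINF_greatest) (auto simp: g_def)
    then show ?thesis by simp
  qed
  then have "g x - g y \<le> L * dist x y \<and> g y - g x \<le> L * dist x y" for x y
    by (metis dist_commute diff_le_eq add.commute)
  then have "L-lipschitz_on UNIV g"
    using L by (intro lipschitz_onI) (auto simp: dist_real_def abs_le_iff)
  moreover have "g x = f x" if "x \<in> S" for x
  proof (rule antisym)
    show "g x \<le> f x" unfolding g_def using cINF_lower[OF bdd that, of x] by simp
    show "f x \<le> g x" unfolding g_def using False lower[OF that, of _ x] by (intro cINF_greatest) auto
  qed
  ultimately show ?thesis by (rule that)
qed

text \<open>The scalar extension is applied to each coordinate. This enlarges the constant by the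
  dimension, which is harmless because the size of the perturbation is chosen after the
  constant.\<close>

lemma lipschitz_extension:
  fixes f :: "'a::metric_space \<Rightarrow> 'b::euclidean_space"
  assumes "L-lipschitz_on S f"
  obtains M g where "M-lipschitz_on UNIV g" "\<And>x. x \<in> S \<Longrightarrow> g x = f x"
proof -
  have "L-lipschitz_on S (\<lambda>x. f x \<bullet> b)" if "b \<in> Basis" for b
  proof (rule lipschitz_onI)
    fix x y assume "x \<in> S" "y \<in> S"
    then have "norm (f x - f y) \<le> L * dist x y" using lipschitz_onD[OF assms] by (simp add: dist_norm)
    then show "dist (f x \<bullet> b) (f y \<bullet> b) \<le> L * dist x y"
      using Basis_le_norm[OF that, of "f x - f y"] by (simp add: dist_real_def inner_diff_left)
  qed (rule lipschitz_on_nonneg[OF assms])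
  then have "\<exists>g. L-lipschitz_on UNIV g \<and> (\<forall>x\<in>S. g x = f x \<bullet> b)" if "b \<in> Basis" for b
    using lipschitz_extension_real that by (metis (no_types, lifting))
  then obtain g where g: "\<And>b. b \<in> Basis \<Longrightarrow> L-lipschitz_on UNIV (g b)"
    "\<And>b x. b \<in> Basis \<Longrightarrow> x \<in> S \<Longrightarrow> g b x = f x \<bullet> b" by metis
  define G where "G = (\<lambda>x. \<Sum>b\<in>Basis. g b x *\<^sub>R b)"
  have "(DIM('b) * L)-lipschitz_on UNIV G"
  proof (rule lipschitz_onI)
    fix x y
    have "norm (G x - G y) = norm (\<Sum>b\<in>Basis. (g b x - g b y) *\<^sub>R b)"
      by (simp add: G_def sum_subtractf scaleR_diff_left)
    also have "\<dots> \<le> DIM('b) * (L * dist x y)"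
    proof (rule sum_norm_bound)
      fix b :: 'b assume "b \<in> Basis"
      then show "norm ((g b x - g b y) *\<^sub>R b) \<le> L * dist x y"
        using lipschitz_onD[OF g(1), of b x y] by (simp add: dist_real_def)
    qed
    finally show "dist (G x) (G y) \<le> DIM('b) * L * dist x y" by (simp add: dist_norm mult.assoc)
  qed (use lipschitz_on_nonneg[OF assms] in simp)
  moreover have "G x = f x" if "x \<in> S" for x
    using g(2) that by (simp add: G_def euclidean_representation)
  ultimately show ?thesis by (rule that)
qed

text \<open>Solving x + F x = y means finding a fixed point of the contraction x \<mapsto> y - F x.
  The expansion estimate \<open>exp\<close> gives injectivity and a Lipschitz bound for the inverse
  at once.\<close>

lemma homeomorphism_id_plus_contraction:
  fixes F :: "'a::banach \<Rightarrow> 'a"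
  assumes F: "M-lipschitz_on UNIV F" and M: "M < 1"
  shows "\<exists>g. homeomorphism UNIV UNIV (\<lambda>x. x + F x) g"
proof -
  have lip: "norm (F x - F y) \<le> M * norm (x - y)" for x y
    using lipschitz_onD[OF F, of x y] by (simp add: dist_norm)
  have exp: "(1 - M) * norm (x - y) \<le> norm ((x + F x) - (y + F y))" for x y
    using lip[of x y] norm_triangle_ineq2[of "x - y" "F y - F x"]
    by (simp add: algebra_simps norm_minus_commute)
  have "\<exists>!x. y - F x = x" for y
    using lip lipschitz_on_nonneg[OF F] M
    by (intro banach_fix_type[of M]) (auto simp: dist_norm norm_minus_commute)
  then obtain g where g: "\<And>y. y - F (g y) = g y" by metis
  have right: "g y + F (g y) = y" for y using g[of y] by (simp add: algebra_simps)
  have left: "g (x + F x) = x" for x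
    using exp[of "g (x + F x)" x] right[of "x + F x"] M by (simp add: mult_le_0_iff)
  have "(1 / (1 - M))-lipschitz_on UNIV g"
  proof (rule lipschitz_onI)
    fix x y
    show "dist (g x) (g y) \<le> 1 / (1 - M) * dist x y"
      using exp[of "g x" "g y"] right M by (simp add: dist_norm field_simps)
  qed (use M in simp)
  then have "continuous_on UNIV g" by (rule lipschitz_on_continuous_on)
  moreover have "continuous_on UNIV F" using F by (rule lipschitz_on_continuous_on)
  ultimately have "homeomorphism UNIV UNIV (\<lambda>x. x + F x) g"
    unfolding homeomorphism_def using left right
    by (auto intro!: continuous_intros simp: image_def) metis+
  then show ?thesis by blast
qed

text \<open>The isotopies run simultaneously, as \<open>k t \<circ> h t\<close>, instead of one
  after the other, which avoids gluing in time; at time 0 the composite is the identity because both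
  factors are.\<close>

lemma ambient_isotopic_trans:
  assumes "ambient_isotopic A B" "ambient_isotopic B C"
  shows "ambient_isotopic A C"
proof -
  obtain h :: "real \<Rightarrow> real^3 \<Rightarrow> real^3" where h: "continuous_on ({0..1} \<times> UNIV) (\<lambda>(t, x). h t x) \<and>
      (\<forall>t\<in>{0..1}. \<exists>g. homeomorphism UNIV UNIV (h t) g) \<and> h 0 = id \<and> h 1 ` A = B"
    using assms(1) unfolding ambient_isotopic_def ..
  obtain k :: "real \<Rightarrow> real^3 \<Rightarrow> real^3" where k: "continuous_on ({0..1} \<times> UNIV) (\<lambda>(t, x). k t x) \<and>
      (\<forall>t\<in>{0..1}. \<exists>g. homeomorphism UNIV UNIV (k t) g) \<and> k 0 = id \<and> k 1 ` B = C"
    using assms(2) unfolding ambient_isotopic_def ..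
  have "continuous_on ({0..1} \<times> UNIV) (\<lambda>z. (fst z, h (fst z) (snd z)))"
    using h by (auto simp: split_beta intro!: continuous_intros)
  from continuous_on_compose2[OF conjunct1[OF k] this]
  have "continuous_on ({0..1} \<times> UNIV) (\<lambda>(t, x). (k t \<circ> h t) x)"
    by (simp add: split_beta image_subset_iff mem_Times_iff)
  moreover have "\<exists>g. homeomorphism UNIV UNIV (k t \<circ> h t) g" if "t \<in> {0..1}" for t
    using homeomorphism_compose h k that by blast
  moreover have "k 0 \<circ> h 0 = id" "(k 1 \<circ> h 1) ` A = C"
    using h k by (auto simp: image_comp[symmetric])
  ultimately show ?thesis
    unfolding ambient_isotopic_def by (intro exI[of _ "\<lambda>t. k t \<circ> h t"]) (auto simp: o_def)
qed

text \<open>The mean value bound for q divided by the chord-arc constant of \<gamma> is the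
  Lipschitz constant of q as a function on the curve. The isotopy then moves every point x of space
  along the segment in direction F x.\<close>

lemma ambient_isotopic_perturbation:
  fixes \<gamma> q :: "real \<Rightarrow> real^3"
  assumes \<gamma>: "smooth_simple_closed_curve \<gamma>"
    and q: "smooth_curve q" "\<And>t. q (t + 1) = q t"
  obtains d0 where "d0 > 0"
    "\<And>d. 0 < d \<Longrightarrow> d < d0 \<Longrightarrow> inj_on (\<lambda>t. \<gamma> t + d *\<^sub>R q t) {0..<1} \<and>
       ambient_isotopic (range \<gamma>) (range (\<lambda>t. \<gamma> t + d *\<^sub>R q t))"
proof -
  have per: "\<And>t. \<gamma> (t + 1) = \<gamma> t" and inj: "inj_on \<gamma> {0..<1}"
    using \<gamma> by (auto simp: smooth_simple_closed_curve_def smooth_immersed_closed_curve_def)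
  obtain c where c: "c > 0" "\<And>s h. \<bar>h\<bar> \<le> 1/2 \<Longrightarrow> c * \<bar>h\<bar> \<le> norm (\<gamma> (s + h) - \<gamma> s)"
    using chord_arc[OF \<gamma>] by blast
  have "continuous_on UNIV (vderiv q)"
    by (intro smooth_curve_continuous smooth_curve_vderiv q)
  then obtain M where M: "M > 0" "\<And>t. norm (vderiv q t) \<le> M"
    using periodic_continuous_bounded[of "vderiv q"] periodic_vderiv[OF q] by metis
  have qM: "norm (q s - q t) \<le> M * \<bar>s - t\<bar>" for s t
    using differentiable_bound[of UNIV q "\<lambda>t x. x *\<^sub>R vderiv q t" M s t] M(2)
      smooth_curve_has_vector_derivative[OF q(1)]
    by (simp add: has_vector_derivative_def onorm_scaleR_left onorm_id)
  have key: "norm (q s - q t) \<le> M / c * norm (\<gamma> s - \<gamma> t)" for s t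
  proof -
    \<comment> \<open>Rounding picks the representative of s - t modulo 1 that lies in [-1/2, 1/2],
      the range of \<open>chord_arc\<close>.\<close>
    define n where "n = round (s - t)"
    define h where "h = s - t - of_int n"
    interpret P: periodic_fun_simple' \<gamma> by unfold_locales (rule per)
    interpret Q: periodic_fun_simple' q by unfold_locales (rule q(2))
    have h: "\<bar>h\<bar> \<le> 1/2"
      using of_int_round_abs_le[of "s - t"] by (simp add: h_def n_def abs_minus_commute)
    have s: "s = t + h + of_int n" by (simp add: h_def)
    have "norm (q s - q t) = norm (q (t + h) - q t)" unfolding s by (simp add: Q.plus_of_int)
    also have "\<dots> \<le> M * \<bar>h\<bar>" using qM[of "t + h" t] by simp
    also have "\<dots> = M / c * (c * \<bar>h\<bar>)" using c(1) by simp
    also have "\<dots> \<le> M / c * norm (\<gamma> (t + h) - \<gamma> t)"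
      using c h M(1) by (intro mult_left_mono) auto
    also have "\<gamma> (t + h) = \<gamma> s" unfolding s by (simp add: P.plus_of_int)
    finally show ?thesis .
  qed
  text \<open>By \<open>key\<close>, all preimages of a point under \<open>\<gamma>\<close> have the same image under \<open>q\<close>.\<close>
  define F0 where "F0 = (\<lambda>x. q (SOME t. \<gamma> t = x))"
  have F0: "F0 (\<gamma> t) = q t" for t
    using key[of "SOME s. \<gamma> s = \<gamma> t" t] someI[of "\<lambda>s. \<gamma> s = \<gamma> t" t] by (simp add: F0_def)
  have "(M / c)-lipschitz_on (range \<gamma>) F0"
    using key M(1) c(1) by (intro lipschitz_onI) (auto simp: F0 dist_norm)
  then obtain L F where F: "L-lipschitz_on UNIV F" "\<And>x. x \<in> range \<gamma> \<Longrightarrow> F x = F0 x"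
    using lipschitz_extension by blast
  have L: "L \<ge> 0" using F(1) by (rule lipschitz_on_nonneg)
  have contF: "continuous_on A F" for A
    using lipschitz_on_continuous_on[OF F(1)] continuous_on_subset by blast
  show ?thesis
  \<comment> \<open>The summand 1 covers L = 0 and still forces d * L < 1, the contraction condition
    at the final time and hence at all earlier ones.\<close>
  proof (rule that[of "1 / (L + 1)"])
    show "1 / (L + 1) > 0" using L by simp
    fix d :: real assume d: "0 < d" "d < 1 / (L + 1)"
    have dL: "d * L < 1" using d L by (simp add: field_simps)
    define h where "h = (\<lambda>t x. x + (t * d) *\<^sub>R F x)"
    have homeo: "\<exists>g. homeomorphism UNIV UNIV (h t) g" if "t \<in> {0..1}" for t
    proof -
      have "(t * d * L)-lipschitz_on UNIV (\<lambda>x. (t * d) *\<^sub>R F x)"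
        using that d lipschitz_on_cmult_nonneg[OF F(1), of "t * d"] by simp
      moreover have "t * d * L < 1"
      proof -
        have "t * (d * L) \<le> d * L" using that d L by (intro mult_left_le_one_le) auto
        then show ?thesis using dL by (simp only: mult.assoc)
      qed
      ultimately show ?thesis unfolding h_def by (rule homeomorphism_id_plus_contraction)
    qed
    have h1: "h 1 (\<gamma> t) = \<gamma> t + d *\<^sub>R q t" for t by (simp add: h_def F F0)
    obtain g where "homeomorphism UNIV UNIV (h 1) g" using homeo[of 1] by auto
    then have "inj (h 1)" by (metis homeomorphism_apply1 inj_on_inverseI)
    then have "inj_on (\<lambda>t. h 1 (\<gamma> t)) {0..<1}"
      using inj by (auto simp: inj_on_def)
    moreover have "ambient_isotopic (range \<gamma>) (range (\<lambda>t. \<gamma> t + d *\<^sub>R q t))"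
      unfolding ambient_isotopic_def
    proof (intro exI[of _ h] conjI ballI)
      show "continuous_on ({0..1} \<times> UNIV) (\<lambda>(t, x). h t x)"
        unfolding h_def split_beta
        by (intro continuous_intros continuous_on_compose2[OF contF[of UNIV]]) auto
      show "h 0 = id" by (auto simp: h_def)
      show "h 1 ` range \<gamma> = range (\<lambda>t. \<gamma> t + d *\<^sub>R q t)"
        by (simp add: image_image h1)
    qed (rule homeo)
    ultimately show "inj_on (\<lambda>t. \<gamma> t + d *\<^sub>R q t) {0..<1} \<and>
       ambient_isotopic (range \<gamma>) (range (\<lambda>t. \<gamma> t + d *\<^sub>R q t))"
      by (simp add: h1)
  qed
qed

section \<open>Squashing space towards a plane\<close>

text \<open>For unit \<open>w\<close> this scales the component along \<open>w\<close> by
  \<open>e\<close> and fixes the orthogonal plane. At e = 1 it is the identity and at e = 0 the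
  orthogonal projection, so the flat curve and its squashed lifts form one family in space,
  continuous in \<open>e\<close>.\<close>

definition squash :: "'a::real_inner \<Rightarrow> real \<Rightarrow> 'a \<Rightarrow> 'a" where
  "squash w e x = x + ((e - 1) * (x \<bullet> w)) *\<^sub>R w"

lemma bounded_linear_squash: "bounded_linear (squash w e)"
  unfolding squash_def
  by (intro bounded_linear_add bounded_linear_ident bounded_linear_scaleR_const[of "\<lambda>x. (e - 1) * (x \<bullet> w)" for x]
      bounded_linear_const_mult bounded_linear_inner_left)

lemma squash_squash:
  assumes "norm w = 1"
  shows "squash w a (squash w b x) = squash w (a * b) x"
proof -
  have "w \<bullet> w = 1" using assms by (simp add: norm_eq_1)
  then show ?thesis by (simp add: squash_def inner_add_left algebra_simps)
qed

lemma squash_1: "squash w 1 = id"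
  by (auto simp: squash_def)

lemma homeomorphism_squash:
  assumes "norm w = 1" "e \<noteq> 0"
  shows "homeomorphism UNIV UNIV (squash w e) (squash w (1 / e))"
proof -
  have "squash w (1 / e) (squash w e x) = x" "squash w e (squash w (1 / e) x) = x" for x
    using assms by (simp_all add: squash_squash squash_1)
  then show ?thesis
    unfolding homeomorphism_def
    by (auto intro!: linear_continuous_on bounded_linear_squash simp: image_def) metis+
qed

text \<open>The scaling factor moves linearly from 1 to \<open>e\<close> and stays positive, so
  every stage is invertible.\<close>

lemma ambient_isotopic_squash:
  assumes "norm w = 1" "e > 0"
  shows "ambient_isotopic A (squash w e ` A)"
  unfolding ambient_isotopic_def
proof (intro exI[of _ "\<lambda>t. squash w (1 - t + t * e)"] conjI ballI)
  show "continuous_on ({0..1} \<times> UNIV) (\<lambda>(t, x). squash w (1 - t + t * e) x)"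
    unfolding squash_def split_beta by (intro continuous_intros)
  fix t :: real assume t: "t \<in> {0..1}"
  have "1 - t + t * e \<noteq> 0"
  proof (cases "t = 1")
    case False
    then have "1 - t > 0" "t * e \<ge> 0" using t assms(2) by auto
    then show ?thesis by linarith
  qed (use assms in auto)
  then show "\<exists>g. homeomorphism UNIV UNIV (squash w (1 - t + t * e)) g"
    using homeomorphism_squash[OF assms(1)] by blast
qed (auto simp: squash_1)

section \<open>Turning of planar curves\<close>

lemma continuous_antiderivative:
  fixes f :: "real \<Rightarrow> 'a::euclidean_space"
  assumes "continuous_on UNIV f"
  obtains F where "\<And>x. (F has_vector_derivative f x) (at x)"
  using einterval_antiderivative[of "-\<infinity>" "\<infinity>" f] assms
  by (auto simp: continuous_on_eq_continuous_at)

text \<open>For an antiderivative G of z'/z the product z * exp (- G) has derivative 0. Hence z = C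
  * exp G, and the angle is Im G plus the argument of C.\<close>

lemma argument_lift:
  fixes z z' :: "real \<Rightarrow> complex"
  assumes z: "\<And>t. (z has_vector_derivative z' t) (at t)"
    and z': "continuous_on UNIV z'" and nz: "\<And>t. z t \<noteq> 0"
  obtains \<theta> where "\<And>t. (\<theta> has_real_derivative Im (z' t / z t)) (at t)"
    "\<And>t. z t = of_real (norm (z t)) * cis (\<theta> t)"
proof -
  have "continuous_on UNIV z"
    by (metis z has_vector_derivative_continuous continuous_at_imp_continuous_on)
  then have "continuous_on UNIV (\<lambda>t. z' t / z t)"
    using z' nz by (intro continuous_intros) auto
  then obtain G where G: "\<And>t. (G has_vector_derivative z' t / z t) (at t)"
    using continuous_antiderivative by blast
  have "((\<lambda>t. z t * exp (- G t)) has_vector_derivative 0) (at t)" for t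
  proof -
    have "((\<lambda>t. exp (- G t)) has_vector_derivative (- (z' t / z t)) * exp (- G t)) (at t)"
      using field_vector_diff_chain_at[OF has_vector_derivative_minus[OF G[of t]] DERIV_exp]
      by (simp add: o_def)
    from has_vector_derivative_mult[OF z[of t] this] show ?thesis using nz[of t] by simp
  qed
  then obtain C where C: "\<And>t. z t * exp (- G t) = C"
    using has_vector_derivative_zero_constant[of UNIV "\<lambda>t. z t * exp (- G t)"] by auto
  have zC: "z t = C * exp (G t)" for t
    using C[of t] by (simp add: exp_minus field_simps)
  have "C \<noteq> 0" using nz[of 0] zC[of 0] by auto
  show ?thesis
  proof (rule that[of "\<lambda>t. Im (G t) + Arg C"])
    fix t
    have "((\<lambda>t. Im (G t)) has_real_derivative Im (z' t / z t)) (at t)"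
      unfolding has_real_derivative_iff_has_vector_derivative
      by (rule bounded_linear.has_vector_derivative[OF bounded_linear_Im G])
    from DERIV_add[OF this DERIV_const]
    show "((\<lambda>t. Im (G t) + Arg C) has_real_derivative Im (z' t / z t)) (at t)" by simp
    have "z t = of_real (norm C) * cis (Arg C) * (of_real (exp (Re (G t))) * cis (Im (G t)))"
      using zC[of t] rcis_cmod_Arg[of C] by (simp add: exp_eq_polar rcis_def)
    also have "\<dots> = of_real (norm C * exp (Re (G t))) * cis (Im (G t) + Arg C)"
      by (simp add: cis_mult[symmetric] mult_ac)
    also have "norm C * exp (Re (G t)) = norm (z t)"
      unfolding zC[of t] by (simp add: norm_mult)
    finally show "z t = of_real (norm (z t)) * cis (Im (G t) + Arg C)" .
  qed
qed

lemma local_max_iff_angle: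
  fixes \<phi> \<theta> r :: "real \<Rightarrow> real"
  assumes \<phi>: "\<And>t. (\<phi> has_real_derivative r t * cos (\<theta> t - \<alpha>)) (at t)"
    and r: "\<And>t. r t > 0" and \<theta>: "strict_mono \<theta>" "continuous_on UNIV \<theta>"
  shows "(\<forall>\<^sub>F s in at t. \<phi> s \<le> \<phi> t) \<longleftrightarrow> (\<exists>m::int. \<theta> t = \<alpha> + pi / 2 + 2 * pi * m)"
proof -
  have "isCont \<theta> t" using \<theta>(2) by (simp add: continuous_on_eq_continuous_at)
  \<comment> \<open>Within this distance \<theta> changes by less than \<pi>, so sin (\<theta> s -
    \<theta> t) has the sign of s - t.\<close>
  then obtain e where e: "e > 0" "\<And>s. \<bar>s - t\<bar> < e \<Longrightarrow> \<bar>\<theta> s - \<theta> t\<bar> < pi"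
    unfolding continuous_at_eps_delta dist_real_def using pi_gt_zero by blast
  have right: "sin (\<theta> s - \<theta> t) > 0" if "t < s" "s < t + e" for s
    using e(2)[of s] that strict_monoD[OF \<theta>(1) that(1)] by (intro sin_gt_zero) auto
  have left: "sin (\<theta> s - \<theta> t) < 0" if "t - e < s" "s < t" for s
    using e(2)[of s] that strict_monoD[OF \<theta>(1) that(2)] sin_gt_zero[of "\<theta> t - \<theta> s"]
      sin_minus[of "\<theta> t - \<theta> s"] by auto
  have cont: "continuous_on A \<phi>" for A
    using \<phi> by (meson DERIV_isCont continuous_at_imp_continuous_on)
  show ?thesis
  proof
    assume "\<exists>m::int. \<theta> t = \<alpha> + pi / 2 + 2 * pi * m"
    then obtain m :: int where m: "\<theta> t = \<alpha> + pi / 2 + 2 * pi * m" by blast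
    have cos: "cos (\<theta> s - \<alpha>) = - sin (\<theta> s - \<theta> t)" for s
    proof -
      have "cos (\<theta> s - \<alpha>) = cos (pi / 2 + (\<theta> s - \<theta> t) + 2 * pi * m)"
        unfolding m by (rule arg_cong[of _ _ cos]) (simp add: algebra_simps)
      also have "\<dots> = cos (pi / 2 + (\<theta> s - \<theta> t))"
        by (subst cos.plus_of_int[symmetric, of _ m]) (simp add: mult_ac)
      finally show ?thesis by (simp add: cos_add)
    qed
    have "\<phi> s \<le> \<phi> t" if "s \<noteq> t" "dist s t < e" for s
    proof (cases "s < t")
      case True
      have "\<phi> s < \<phi> t"
      proof (rule DERIV_pos_imp_increasing_open[OF True])
        fix x assume "s < x" "x < t"
        then show "\<exists>y. (\<phi> has_real_derivative y) (at x) \<and> y > 0"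
          using \<phi>[of x] left[of x] r[of x] that True by (auto simp: cos dist_real_def mult_pos_neg)
      qed (rule cont)
      then show ?thesis by simp
    next
      case False
      then have "t < s" using that by simp
      then have "\<phi> t > \<phi> s"
      proof (rule DERIV_neg_imp_decreasing_open)
        fix x assume "t < x" "x < s"
        then show "\<exists>y. (\<phi> has_real_derivative y) (at x) \<and> y < 0"
          using \<phi>[of x] right[of x] r[of x] that by (auto simp: cos dist_real_def)
      qed (rule cont)
      then show ?thesis by simp
    qed
    then show "\<forall>\<^sub>F s in at t. \<phi> s \<le> \<phi> t"
      unfolding eventually_at using e(1) by auto
  next
    assume "\<forall>\<^sub>F s in at t. \<phi> s \<le> \<phi> t"
    then obtain b where b: "b > 0" "\<And>s. s \<noteq> t \<Longrightarrow> dist s t < b \<Longrightarrow> \<phi> s \<le> \<phi> t"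
      unfolding eventually_at by auto
    have "r t * cos (\<theta> t - \<alpha>) = 0"
      using b by (intro DERIV_local_max[OF \<phi>[of t] b(1)]) (metis dist_real_def dist_commute order_refl)
    then have "cos (\<theta> t - \<alpha>) = 0" using r[of t] by simp
    then obtain i :: int where i: "odd i" "\<theta> t - \<alpha> = of_int i * (pi / 2)"
      unfolding cos_zero_iff_int by blast
    then obtain j where j: "i = 2 * j + 1" by (elim oddE)
    show "\<exists>m::int. \<theta> t = \<alpha> + pi / 2 + 2 * pi * m"
    proof (cases "even j")
      case True
      then obtain m where "j = 2 * m" by (elim evenE)
      then show ?thesis using i(2) j by (intro exI[of _ m]) (simp add: algebra_simps)
    next
      \<comment> \<open>These are the critical points where the tangent points opposite to the
        tangent at a maximum: \<phi> increases to the right of t, contradicting the local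
        maximum.\<close>
      case False
      then obtain m where m: "j = 2 * m + 1" by (elim oddE)
      have cos: "cos (\<theta> s - \<alpha>) = sin (\<theta> s - \<theta> t)" for s
      proof -
        have "cos (\<theta> s - \<alpha>) = cos (3 * pi / 2 + (\<theta> s - \<theta> t) + 2 * pi * m)"
          using i(2) unfolding j m by (intro arg_cong[of _ _ cos]) (simp add: algebra_simps)
        also have "\<dots> = cos (3 * pi / 2 + (\<theta> s - \<theta> t))"
          by (subst cos.plus_of_int[symmetric, of _ m]) (simp add: mult_ac)
        also have "\<dots> = sin (\<theta> s - \<theta> t)"
        proof -
          have "3 * pi / 2 = 3 / 2 * pi" by simp
          then have "cos (3 * pi / 2) = 0" "sin (3 * pi / 2) = -1"
            by (simp_all only: cos_3over2_pi sin_3over2_pi)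
          then show ?thesis by (simp add: cos_add)
        qed
        finally show ?thesis .
      qed
      define s where "s = t + min b e / 2"
      have s: "t < s" "s < t + e" "dist s t < b" using b e by (auto simp: s_def dist_real_def)
      from s(1) have "\<phi> t < \<phi> s"
      proof (rule DERIV_pos_imp_increasing_open)
        fix x assume "t < x" "x < s"
        then show "\<exists>y. (\<phi> has_real_derivative y) (at x) \<and> y > 0"
          using \<phi>[of x] right[of x] r[of x] s by (auto simp: cos)
      qed (rule cont)
      moreover have "\<phi> s \<le> \<phi> t" using b(2) s by simp
      ultimately show ?thesis by simp
    qed
  qed
qed

text \<open>Over one half-open period \<theta> runs once through [\<theta> 0, \<theta> 0 + 2\<pi>n),
  which meets each residue class modulo 2\<pi> exactly n times.\<close>

lemma card_angle_hits:
  fixes \<theta> :: "real \<Rightarrow> real" and n :: nat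
  assumes \<theta>: "strict_mono \<theta>" "continuous_on UNIV \<theta>" and n: "\<theta> 1 = \<theta> 0 + 2 * pi * n"
  shows "card {t \<in> {0..<1}. \<exists>m::int. \<theta> t = c + 2 * pi * m} = n"
proof -
  define x where "x = (\<theta> 0 - c) / (2 * pi)"
  let ?T = "{t \<in> {0..<1}. \<exists>m::int. \<theta> t = c + 2 * pi * m}"
  have \<theta>0: "\<theta> 0 = c + 2 * pi * x" by (simp add: x_def)
  \<comment> \<open>On \<open>?T\<close> the quotient is already an integer; the floor only turns it
    into an \<open>int\<close>, and the hits are counted by these integers.\<close>
  have inj: "inj_on (\<lambda>t. \<lfloor>(\<theta> t - c) / (2 * pi)\<rfloor>) ?T"
  proof (rule inj_onI)
    fix s t assume "s \<in> ?T" "t \<in> ?T" "\<lfloor>(\<theta> s - c) / (2 * pi)\<rfloor> = \<lfloor>(\<theta> t - c) / (2 * pi)\<rfloor>"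
    then have "\<theta> s = \<theta> t" by auto
    then show "s = t" using strict_mono_eq[OF \<theta>(1)] by blast
  qed
  have img: "(\<lambda>t. \<lfloor>(\<theta> t - c) / (2 * pi)\<rfloor>) ` ?T = {\<lceil>x\<rceil>..<\<lceil>x\<rceil> + int n}"
  proof (intro equalityI subsetI)
    fix m assume "m \<in> (\<lambda>t. \<lfloor>(\<theta> t - c) / (2 * pi)\<rfloor>) ` ?T"
    then obtain t where t: "0 \<le> t" "t < 1" "\<theta> t = c + 2 * pi * m" by auto
    have "\<theta> 0 \<le> \<theta> t" "\<theta> t < \<theta> 1"
      using t(1,2) strict_mono_less_eq[OF \<theta>(1)] strict_mono_less[OF \<theta>(1)] by blast+
    then have "2 * pi * x \<le> 2 * pi * m" "2 * pi * m < 2 * pi * (x + n)"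
      unfolding t(3) n \<theta>0 by (simp_all add: distrib_left)
    then have "x \<le> m" "of_int (m - int n) < x" by auto
    then show "m \<in> {\<lceil>x\<rceil>..<\<lceil>x\<rceil> + int n}" by (auto simp: ceiling_le_iff less_ceiling_iff)  linarith
  next
    fix m assume "m \<in> {\<lceil>x\<rceil>..<\<lceil>x\<rceil> + int n}"
    then have "x \<le> m" "of_int (m - int n) < x" by (auto simp: ceiling_le_iff) linarith
    then have "2 * pi * x \<le> 2 * pi * m" "2 * pi * m < 2 * pi * (x + n)" by auto
    then have *: "\<theta> 0 \<le> c + 2 * pi * m" "c + 2 * pi * m < \<theta> 1"
      unfolding n \<theta>0 by (simp_all add: distrib_left)
    then obtain t where t: "0 \<le> t" "t \<le> 1" "\<theta> t = c + 2 * pi * m"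
      using IVT'[of \<theta> 0 "c + 2 * pi * m" 1] continuous_on_subset[OF \<theta>(2)] by auto
    \<comment> \<open>The intermediate value theorem allows t = 1; the strict inequality below
      \<theta> 1 excludes it.\<close>
    then have "t \<in> ?T" using * by (cases "t = 1") auto
    then show "m \<in> (\<lambda>t. \<lfloor>(\<theta> t - c) / (2 * pi)\<rfloor>) ` ?T"
      using t(3) by (intro image_eqI[of _ _ t]) auto
  qed
  show ?thesis using card_image[OF inj] unfolding img by simp
qed

text \<open>A nondecreasing function that is not strictly increasing is constant on some interval,
  and there its derivative has zeros that are not isolated.\<close>

lemma strict_mono_if_deriv_isolated_zeros:
  fixes f f' :: "real \<Rightarrow> real"
  assumes f: "\<And>t. (f has_real_derivative f' t) (at t)" and nn: "\<And>t. f' t \<ge> 0"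
    and iso: "\<And>t. f' t = 0 \<Longrightarrow> \<forall>\<^sub>F s in at t. f' s \<noteq> 0"
  shows "strict_mono f"
proof (rule strict_monoI)
  fix a b :: real assume "a < b"
  have mono: "f x \<le> f y" if "x \<le> y" for x y
    using DERIV_nonneg_imp_nondecreasing[OF that] f nn by blast
  show "f a < f b"
  proof (rule ccontr)
    assume "\<not> f a < f b"
    then have const: "f x = f a" if "x \<in> {a<..<b}" for x
      using mono[of a x] mono[of x b] that by auto
    have zero: "f' x = 0" if "x \<in> {a<..<b}" for x
    proof (rule DERIV_unique)
      show "(f has_real_derivative 0) (at x)"
        using has_field_derivative_transform_within_open[of "\<lambda>_. f a" 0 x "{a<..<b}" f] const that
        by auto
    qed (rule f)
    define m where "m = (a + b) / 2"
    have m: "m \<in> {a<..<b}" using \<open>a < b\<close> by (simp add: m_def)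
    have "\<forall>\<^sub>F s in at m. s \<in> {a<..<b}"
      using m eventually_at_in_open'[of "{a<..<b}" m] by simp
    moreover have "\<forall>\<^sub>F s in at m. f' s \<noteq> 0" using iso zero m by blast
    ultimately have "\<forall>\<^sub>F s in at m. False" by eventually_elim (use zero in blast)
    then show False by simp
  qed
qed

lemma has_vector_derivative_sgn:
  fixes c :: "real \<Rightarrow> 'a::real_inner"
  assumes c: "(c has_vector_derivative c') (at t)" and nz: "c t \<noteq> 0"
  shows "((\<lambda>s. sgn (c s)) has_vector_derivative
    (c' - (sgn (c t) \<bullet> c') *\<^sub>R sgn (c t)) /\<^sub>R norm (c t)) (at t)"
proof -
  have "((\<lambda>s. norm (c s)) has_real_derivative sgn (c t) \<bullet> c') (at t)"
    using has_derivative_compose[OF c[unfolded has_vector_derivative_def] has_derivative_norm[OF nz]]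
    by (simp add: has_field_derivative_def mult_commute_abs inner_commute)
  from DERIV_inverse_fun[OF this] nz
  have "((\<lambda>s. inverse (norm (c s))) has_real_derivative
     - (inverse (norm (c t)) * (sgn (c t) \<bullet> c') * inverse (norm (c t)))) (at t)" by (simp add: mult_ac)
  from has_vector_derivative_scaleR[OF this c]
  show ?thesis
    by (simp add: sgn_div_norm scaleR_diff_right algebra_simps)
qed

lemma constant_sign_on_interval:
  fixes k :: "real \<Rightarrow> real"
  assumes "continuous_on UNIV k" "\<And>s. a < s \<Longrightarrow> s < b \<Longrightarrow> k s \<noteq> 0"
  shows "(\<forall>s\<in>{a<..<b}. k s > 0) \<or> (\<forall>s\<in>{a<..<b}. k s < 0)"
proof (rule ccontr)
  assume "\<not> ?thesis"
  then obtain x y where xy: "x \<in> {a<..<b}" "y \<in> {a<..<b}" "k x \<le> 0" "k y \<ge> 0"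
    by (auto simp: not_less)
  have "connected (k ` {a<..<b})"
    using assms(1) by (intro connected_continuous_image) (auto intro: continuous_on_subset)
  then have "0 \<in> k ` {a<..<b}"
    using xy by (auto dest: connectedD_interval[where x = "k x" and y = "k y" and z = 0])
  then show False using assms(2) by auto
qed

text \<open>The line splits into the points with positive and those with negative values on a
  punctured neighbourhood. Puncturing lets a zero without sign change join one of the two sets; both
  are open and disjoint, so one is empty by connectedness.\<close>

lemma no_sign_change:
  fixes k :: "real \<Rightarrow> real"
  assumes cont: "continuous_on UNIV k" and iso: "\<And>t. k t = 0 \<Longrightarrow> \<forall>\<^sub>F s in at t. k s \<noteq> 0"
    and no: "\<And>t. k t = 0 \<Longrightarrow> \<not> ((\<forall>\<^sub>F s in at_left t. k s < 0) \<and> (\<forall>\<^sub>F s in at_right t. k s > 0) \<or>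
      (\<forall>\<^sub>F s in at_left t. k s > 0) \<and> (\<forall>\<^sub>F s in at_right t. k s < 0))"
  shows "(\<forall>t. k t \<ge> 0) \<or> (\<forall>t. k t \<le> 0)"
proof -
  define A where "A = {t. \<forall>\<^sub>F s in at t. k s > 0}"
  define B where "B = {t. \<forall>\<^sub>F s in at t. k s < 0}"
  have isC: "isCont k t" for t using cont by (simp add: continuous_on_eq_continuous_at)
  have pos: "t \<in> A" if "k t > 0" for t
    using order_tendstoD(1)[OF isC[unfolded isCont_def] that] by (simp add: A_def)
  have neg: "t \<in> B" if "k t < 0" for t
    using order_tendstoD(2)[OF isC[unfolded isCont_def] that] by (simp add: B_def)
  have "A \<union> B = UNIV"
  proof -
    have "t \<in> A \<union> B" if kt: "k t = 0" for t
    proof -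
      obtain e where e: "e > 0" "\<And>s. s \<noteq> t \<Longrightarrow> dist s t < e \<Longrightarrow> k s \<noteq> 0"
        using iso[OF kt] unfolding eventually_at by auto
      have nz: "k s \<noteq> 0" if "t - e < s" "s < t + e" "s \<noteq> t" for s
        using e(2)[of s] that by (auto simp: dist_real_def)
      have l: "(\<forall>s\<in>{t-e<..<t}. k s > 0) \<or> (\<forall>s\<in>{t-e<..<t}. k s < 0)"
        and r: "(\<forall>s\<in>{t<..<t+e}. k s > 0) \<or> (\<forall>s\<in>{t<..<t+e}. k s < 0)"
        using nz e(1) by (auto intro!: constant_sign_on_interval[OF cont])
      have fl: "\<forall>\<^sub>F s in at_left t. s \<in> {t-e<..<t}" and fr: "\<forall>\<^sub>F s in at_right t. s \<in> {t<..<t+e}"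
        using e(1) eventually_at_left_real[of "t - e" t] eventually_at_right_real[of t "t + e"] by simp_all
      have "(\<forall>\<^sub>F s in at_left t. k s > 0) \<or> (\<forall>\<^sub>F s in at_left t. k s < 0)"
        using l by (auto intro: eventually_mono[OF fl])
      moreover have "(\<forall>\<^sub>F s in at_right t. k s > 0) \<or> (\<forall>\<^sub>F s in at_right t. k s < 0)"
        using r by (auto intro: eventually_mono[OF fr])
      ultimately show ?thesis
        using no[OF kt] by (auto simp: A_def B_def eventually_at_split)
    qed
    then show ?thesis using pos neg by (metis UNIV_eq_I Un_iff linorder_less_linear)
  qed
  moreover have "open A" "open B"
  proof -
    have "\<exists>T. open T \<and> t \<in> T \<and> T \<subseteq> A" if t: "t \<in> A" for t
    proof -
      obtain T where "open T" "t \<in> T" "\<forall>s\<in>T. s \<noteq> t \<longrightarrow> k s > 0"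
        using t unfolding A_def by (auto simp: eventually_at_topological)
      then show ?thesis using pos t by (intro exI[of _ T]) (metis subsetI)
    qed
    then show "open A" by (subst open_subopen) blast
    have "\<exists>T. open T \<and> t \<in> T \<and> T \<subseteq> B" if t: "t \<in> B" for t
    proof -
      obtain T where "open T" "t \<in> T" "\<forall>s\<in>T. s \<noteq> t \<longrightarrow> k s < 0"
        using t unfolding B_def by (auto simp: eventually_at_topological)
      then show ?thesis using neg t by (intro exI[of _ T]) (metis subsetI)
    qed
    then show "open B" by (subst open_subopen) blast
  qed
  moreover have "A \<inter> B = {}"
  proof -
    have False if "\<forall>\<^sub>F s in at t. k s > 0" "\<forall>\<^sub>F s in at t. k s < 0" for t
    proof -
      from that have "\<forall>\<^sub>F s in at t. False" by eventually_elim simp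
      then show False by simp
    qed
    then show ?thesis by (auto simp: A_def B_def)
  qed
  ultimately have "A = {} \<or> B = {}"
    using connectedD[OF connected_UNIV, of A B] by auto
  then show ?thesis using pos neg by (meson empty_iff not_less)
qed

lemma signed_curvature_eq:
  fixes p :: "real \<Rightarrow> real^2"
  assumes "smooth_curve p" "vderiv p t \<noteq> 0"
  shows "signed_curvature p t =
    (vderiv p t $ 1 * vderiv (vderiv p) t $ 2 - vderiv p t $ 2 * vderiv (vderiv p) t $ 1) / norm (vderiv p t) ^ 3"
proof -
  let ?p' = "vderiv p t" and ?p'' = "vderiv (vderiv p) t"
  have "(unit_tangent p has_vector_derivative
      (?p'' - (sgn ?p' \<bullet> ?p'') *\<^sub>R sgn ?p') /\<^sub>R norm ?p') (at t)"
    unfolding unit_tangent_def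
    using has_vector_derivative_sgn[OF smooth_curve_has_vector_derivative[OF smooth_curve_vderiv[OF assms(1)]] assms(2)] .
  then have T': "vderiv (unit_tangent p) t = (?p'' - (sgn ?p' \<bullet> ?p'') *\<^sub>R sgn ?p') /\<^sub>R norm ?p'"
    unfolding vderiv_def by (rule vector_derivative_at)
  have r: "x \<bullet> rot90 (sgn y) = (y $ 1 * x $ 2 - y $ 2 * x $ 1) / norm y" for x y :: "real^2"
    by (simp add: rot90_def inner_vec_def sum_2 sgn_div_norm diff_divide_distrib divide_inverse algebra_simps)
  have r0: "sgn y \<bullet> rot90 (sgn y) = 0" for y :: "real^2"
    by (simp add: rot90_def inner_vec_def sum_2)
  have "signed_curvature p t = inverse (norm ?p') * (inverse (norm ?p') * (?p'' \<bullet> rot90 (sgn ?p')))"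
    by (simp add: signed_curvature_def arc_deriv_def unit_tangent_def T' inner_diff_left r0)
  then show ?thesis
    by (simp add: r power3_eq_cube divide_inverse mult_ac)
qed

text \<open>The integrand is the derivative of the tangent angle \<theta>, and the tangent closes
  up, so the integral is 2\<pi>n for an integer n. A direction has a local maximum exactly when
  \<theta> hits one residue class modulo 2\<pi>, which happens n times per period for every
  direction.\<close>

lemma spiral_number_eq_turning:
  fixes p :: "real \<Rightarrow> real^2"
  assumes sm: "smooth_curve p" and per: "\<And>t. p (t + 1) = p t" and nz: "\<And>t. vderiv p t \<noteq> 0"
    and W: "\<And>t. W t = vderiv p t $ 1 * vderiv (vderiv p) t $ 2 - vderiv p t $ 2 * vderiv (vderiv p) t $ 1"
    and sgn: "(\<forall>t. W t \<ge> 0) \<or> (\<forall>t. W t \<le> 0)"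
    and iso: "\<And>t. W t = 0 \<Longrightarrow> \<forall>\<^sub>F s in at t. W s \<noteq> 0"
  shows "integral {0..1} (\<lambda>t. \<bar>W t\<bar> / (norm (vderiv p t))\<^sup>2) = 2 * pi * spiral_number p"
proof -
  text \<open>Reflecting the plane if \<open>W \<le> 0\<close> makes the tangent angle increase.\<close>
  obtain \<sigma> :: real where \<sigma>: "\<sigma> * \<sigma> = 1" "\<And>t. \<sigma> * W t = \<bar>W t\<bar>"
    using sgn by (metis abs_of_nonneg abs_of_nonpos mult_1 mult_minus1 mult_minus_left minus_minus mult_1_right)
  define z where "z = (\<lambda>t. Complex (vderiv p t $ 1) (\<sigma> * vderiv p t $ 2))"
  define z' where "z' = (\<lambda>t. Complex (vderiv (vderiv p) t $ 1) (\<sigma> * vderiv (vderiv p) t $ 2))"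
  have \<sigma>2: "\<sigma>\<^sup>2 = 1" using \<sigma>(1) by (simp add: power2_eq_square)
  have sm1: "smooth_curve (vderiv p)" and sm2: "smooth_curve (vderiv (vderiv p))"
    using sm by (auto intro: smooth_curve_vderiv)
  have L: "bounded_linear (\<lambda>x :: real^2. Complex (x $ 1) (\<sigma> * x $ 2))"
    by (auto intro!: linear_conv_bounded_linear[THEN iffD1] linearI simp: algebra_simps complex_eq_iff)
  have norm_z: "norm (z t) = norm (vderiv p t)" for t
    by (simp add: z_def cmod_def norm_vec_def L2_set_def sum_2 power_mult_distrib \<sigma>2)
  have z: "(z has_vector_derivative z' t) (at t)" for t
    unfolding z_def z'_def
    by (rule bounded_linear.has_vector_derivative[OF L smooth_curve_has_vector_derivative[OF sm1]])
  have cz': "continuous_on UNIV z'"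
    unfolding z'_def by (rule bounded_linear.continuous_on[OF L smooth_curve_continuous[OF sm2]])
  have nzz: "z t \<noteq> 0" for t using norm_z[of t] nz[of t] by auto
  have Imz: "Im (z' t / z t) = \<bar>W t\<bar> / (norm (vderiv p t))\<^sup>2" for t
  proof -
    have "Im (z' t / z t) = (\<sigma> * W t) / (norm (z t))\<^sup>2"
      by (simp add: Im_divide cmod_power2 z_def z'_def W algebra_simps)
    then show ?thesis using \<sigma>(2) norm_z by simp
  qed
  from argument_lift[OF z cz' nzz]
  obtain \<theta> where \<theta>: "\<And>t. (\<theta> has_real_derivative \<bar>W t\<bar> / (norm (vderiv p t))\<^sup>2) (at t)"
    and polar: "\<And>t. z t = of_real (norm (vderiv p t)) * cis (\<theta> t)"
    unfolding Imz norm_z by blast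
  have cont\<theta>: "continuous_on UNIV \<theta>"
    using \<theta> by (meson DERIV_isCont continuous_at_imp_continuous_on)
  have mono\<theta>: "strict_mono \<theta>"
    using iso nz by (intro strict_mono_if_deriv_isolated_zeros[OF \<theta>]) auto
  have "vderiv p 1 = vderiv p 0" using periodic_vderiv[OF sm per, of 0] by simp
  then have "cis (\<theta> 1) = cis (\<theta> 0)"
    using polar[of 0] polar[of 1] nz[of 0] by (simp add: z_def)
  then have "cis (\<theta> 1 - \<theta> 0) = 1"
    by (simp add: cis_divide[symmetric])
  then obtain m :: int where m: "\<theta> 1 - \<theta> 0 = 2 * pi * m"
    using cos_one_2pi_int[of "\<theta> 1 - \<theta> 0"] by (auto simp: complex_eq_iff mult_ac)
  have "\<theta> 0 < \<theta> 1" using mono\<theta> by (simp add: strict_mono_less)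
  then have "0 < 2 * pi * real_of_int m" using m by linarith
  then have "m > 0" by (simp add: zero_less_mult_iff)
  then obtain n where n: "m = int n" by (metis zero_less_imp_eq_int)
  have \<theta>n: "\<theta> 1 = \<theta> 0 + 2 * pi * n" using m n by simp
  have "num_local_maxima p d = n" if d: "norm d = 1" for d
  proof -
    have "(norm d)\<^sup>2 = (d $ 1)\<^sup>2 + (d $ 2)\<^sup>2"
      unfolding power2_norm_eq_inner by (simp add: inner_vec_def sum_2 power2_eq_square)
    \<comment> \<open>The direction is reflected together with the curve; since \<sigma> * \<sigma>
      = 1, heights are unaffected.\<close>
    then have "(d $ 1)\<^sup>2 + (\<sigma> * d $ 2)\<^sup>2 = 1"
      using d by (simp add: power_mult_distrib \<sigma>2)
    then obtain \<alpha> where \<alpha>: "d $ 1 = cos \<alpha>" "\<sigma> * d $ 2 = sin \<alpha>" using sincos_total_2pi by metis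
    have "((\<lambda>s. p s \<bullet> d) has_real_derivative norm (vderiv p t) * cos (\<theta> t - \<alpha>)) (at t)" for t
    proof -
      have "((\<lambda>s. p s \<bullet> d) has_real_derivative vderiv p t \<bullet> d) (at t)"
        unfolding has_real_derivative_iff_has_vector_derivative
        by (rule bounded_linear.has_vector_derivative[OF bounded_linear_inner_left
              smooth_curve_has_vector_derivative[OF sm]])
      moreover have "vderiv p t $ 1 = norm (vderiv p t) * cos (\<theta> t)"
        "\<sigma> * vderiv p t $ 2 = norm (vderiv p t) * sin (\<theta> t)"
        using polar[of t] by (simp_all add: z_def complex_eq_iff)
      moreover have "vderiv p t \<bullet> d = vderiv p t $ 1 * d $ 1 + (\<sigma> * vderiv p t $ 2) * (\<sigma> * d $ 2)"
      proof -
        have "(\<sigma> * vderiv p t $ 2) * (\<sigma> * d $ 2) = (\<sigma> * \<sigma>) * (vderiv p t $ 2 * d $ 2)"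
          by (simp only: mult_ac)
        then show ?thesis by (simp add: \<sigma>(1) inner_vec_def sum_2)
      qed
      ultimately show ?thesis by (simp add: \<alpha> cos_diff algebra_simps)
    qed
    from local_max_iff_angle[OF this _ mono\<theta> cont\<theta>]
    have "num_local_maxima p d = card {t \<in> {0..<1}. \<exists>m::int. \<theta> t = \<alpha> + pi / 2 + 2 * pi * m}"
      using nz by (simp add: num_local_maxima_def)
    also have "\<dots> = n" by (rule card_angle_hits[OF mono\<theta> cont\<theta> \<theta>n])
    finally show ?thesis .
  qed
  \<comment> \<open>Some unit vector must exist for the common value to determine the
    \<open>THE\<close> in \<open>spiral_number\<close>.\<close>
  moreover have "norm (axis 1 1 :: real^2) = 1" by simp
  ultimately have "spiral_number p = n"
    unfolding spiral_number_def by (intro the_equality) blast+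
  moreover have "((\<lambda>t. \<bar>W t\<bar> / (norm (vderiv p t))\<^sup>2) has_integral \<theta> 1 - \<theta> 0) {0..1}"
    using \<theta> by (intro fundamental_theorem_of_calculus)
      (auto simp: has_real_derivative_iff_has_vector_derivative intro: has_vector_derivative_at_within)
  ultimately show ?thesis using \<theta>n by (simp add: integral_unique)
qed

section \<open>Curvature and torsion of space curves\<close>

lemma bounded_bilinear_cross3: "bounded_bilinear cross3"
  using bilinear_cross bilinear_conv_bounded_bilinear by blast

lemma triple_product_swap: "cross3 a d \<bullet> b = - (cross3 a b \<bullet> d)"
  by (simp add: cross3_simps)

lemma binet_cauchy: "cross3 a b \<bullet> cross3 c d = (a \<bullet> c) * (b \<bullet> d) - (a \<bullet> d) * (b \<bullet> c)"
  by (simp add: cross3_simps)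

text \<open>The derivative of the unit tangent is the part of b orthogonal to a, divided by the
  speed. The cross product with a kills the tangential part, and orthogonality turns its norm into a
  product of norms.\<close>

lemma unit_tangent_deriv:
  fixes \<gamma> :: "real \<Rightarrow> real^3"
  assumes sm: "smooth_curve \<gamma>" and nz: "cross3 (vderiv \<gamma> t) (vderiv (vderiv \<gamma>) t) \<noteq> 0"
  defines "a \<equiv> vderiv \<gamma> t" and "b \<equiv> vderiv (vderiv \<gamma>) t" and "T' \<equiv> vderiv (unit_tangent \<gamma>) t"
  shows "T' = (b - (sgn a \<bullet> b) *\<^sub>R sgn a) /\<^sub>R norm a"
    and "cross3 a T' = cross3 a b /\<^sub>R norm a"
    and "norm T' = norm (cross3 a b) / (norm a)\<^sup>2"
proof -
  have a: "a \<noteq> 0" using nz by (auto simp: a_def)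
  have "(unit_tangent \<gamma> has_vector_derivative (b - (sgn a \<bullet> b) *\<^sub>R sgn a) /\<^sub>R norm a) (at t)"
    unfolding unit_tangent_def a_def b_def
    using has_vector_derivative_sgn[OF smooth_curve_has_vector_derivative[OF smooth_curve_vderiv[OF sm]]] a
    by (simp add: a_def)
  then show T': "T' = (b - (sgn a \<bullet> b) *\<^sub>R sgn a) /\<^sub>R norm a"
    unfolding T'_def vderiv_def by (rule vector_derivative_at)
  show crs: "cross3 a T' = cross3 a b /\<^sub>R norm a"
    by (simp add: T' sgn_div_norm cross_mult_right Cross3.right_diff_distrib)
  have "a \<bullet> T' = 0"
    using a by (simp add: T' sgn_div_norm inner_diff_right dot_square_norm power2_eq_square inverse_eq_divide)
  then have "(norm (cross3 a T'))\<^sup>2 = (norm a * norm T')\<^sup>2"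
    using norm_cross_dot[of a T'] by simp
  then have "norm (cross3 a T') = norm a * norm T'"
    by (simp add: power2_eq_iff_nonneg)
  then show "norm T' = norm (cross3 a b) / (norm a)\<^sup>2"
    using a by (simp add: crs power2_eq_square field_simps)
qed

lemma curvature_times_speed:
  fixes \<gamma> :: "real \<Rightarrow> real^3"
  assumes sm: "smooth_curve \<gamma>" and nz: "cross3 (vderiv \<gamma> t) (vderiv (vderiv \<gamma>) t) \<noteq> 0"
  shows "curvature \<gamma> t * norm (vderiv \<gamma> t) =
      norm (cross3 (vderiv \<gamma> t) (vderiv (vderiv \<gamma>) t)) / (norm (vderiv \<gamma> t))\<^sup>2"
proof -
  have "vderiv \<gamma> t \<noteq> 0" using nz by auto
  then show ?thesis using unit_tangent_deriv(3)[OF assms] by (simp add: curvature_def arc_deriv_def)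
qed

text \<open>This form lets the binormal be differentiated without differentiating the principal
  normal.\<close>

lemma binormal_eq:
  fixes \<gamma> :: "real \<Rightarrow> real^3"
  assumes sm: "smooth_curve \<gamma>" and nz: "cross3 (vderiv \<gamma> t) (vderiv (vderiv \<gamma>) t) \<noteq> 0"
  shows "binormal \<gamma> t = sgn (cross3 (vderiv \<gamma> t) (vderiv (vderiv \<gamma>) t))"
proof -
  have a: "vderiv \<gamma> t \<noteq> 0" using nz by auto
  have "binormal \<gamma> t = cross3 (sgn (vderiv \<gamma> t)) (sgn (vderiv (unit_tangent \<gamma>) t))"
    using a by (simp add: binormal_def principal_normal_def arc_deriv_def unit_tangent_def[of \<gamma> t] sgn_scaleR)
  also have "\<dots> = cross3 (vderiv \<gamma> t) (vderiv (unit_tangent \<gamma>) t)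
      /\<^sub>R (norm (vderiv \<gamma> t) * norm (vderiv (unit_tangent \<gamma>) t))"
    by (simp add: sgn_div_norm cross_mult_left cross_mult_right mult.commute)
  also have "\<dots> = sgn (cross3 (vderiv \<gamma> t) (vderiv (vderiv \<gamma>) t))"
    unfolding unit_tangent_deriv(2,3)[OF assms]
    using a nz by (simp add: sgn_div_norm power2_eq_square inverse_eq_divide)
  finally show ?thesis .
qed

text \<open>This is the classical formula det(\<gamma>', \<gamma>'', \<gamma>''') / |\<gamma>'
  \<times> \<gamma>''|^2 for the torsion, times the speed. It rests on (\<gamma>' \<times>
  \<gamma>'')' = \<gamma>' \<times> \<gamma>''', as \<gamma>'' \<times> \<gamma>'' = 0.\<close>

lemma torsion_times_speed:
  fixes \<gamma> :: "real \<Rightarrow> real^3"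
  assumes sm: "smooth_curve \<gamma>" and nz: "\<And>t. cross3 (vderiv \<gamma> t) (vderiv (vderiv \<gamma>) t) \<noteq> 0"
  defines "c \<equiv> \<lambda>t. cross3 (vderiv \<gamma> t) (vderiv (vderiv \<gamma>) t)"
  shows "torsion \<gamma> t * norm (vderiv \<gamma> t) =
      norm (vderiv \<gamma> t) * (c t \<bullet> vderiv (vderiv (vderiv \<gamma>)) t) / (norm (c t))\<^sup>2"
proof -
  define a b d T' where "a = vderiv \<gamma> t" "b = vderiv (vderiv \<gamma>) t"
    "d = vderiv (vderiv (vderiv \<gamma>)) t" "T' = vderiv (unit_tangent \<gamma>) t"
  note abd = this
  have ct: "c t = cross3 a b" "c t \<noteq> 0" using nz by (auto simp: c_def abd)
  have a: "a \<noteq> 0" using ct by auto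
  have T': "T' = (b - (sgn a \<bullet> b) *\<^sub>R sgn a) /\<^sub>R norm a" and nT': "norm T' = norm (c t) / (norm a)\<^sup>2"
    using unit_tangent_deriv[OF sm nz, of t] by (auto simp: abd c_def)
  have "(c has_vector_derivative cross3 a d) (at t)"
    using bounded_bilinear.has_vector_derivative[OF bounded_bilinear_cross3
       smooth_curve_has_vector_derivative[OF smooth_curve_vderiv[OF sm], of t]
       smooth_curve_has_vector_derivative[OF smooth_curve_vderiv[OF smooth_curve_vderiv[OF sm]], of t]]
    by (simp add: c_def abd)
  moreover have "binormal \<gamma> = (\<lambda>s. sgn (c s))"
    using binormal_eq[OF sm nz] by (auto simp: c_def)
  ultimately have "(binormal \<gamma> has_vector_derivative
      (cross3 a d - (sgn (c t) \<bullet> cross3 a d) *\<^sub>R sgn (c t)) /\<^sub>R norm (c t)) (at t)"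
    using has_vector_derivative_sgn[of c "cross3 a d" t] ct(2) by simp
  then have B': "vderiv (binormal \<gamma>) t = (cross3 a d - (sgn (c t) \<bullet> cross3 a d) *\<^sub>R sgn (c t)) /\<^sub>R norm (c t)"
    unfolding vderiv_def by (rule vector_derivative_at)
  \<comment> \<open>Normalising \<open>c\<close> contributes a multiple of \<open>c\<close> to the
    derivative of the binormal; it is orthogonal to the normal and drops out.\<close>
  have "c t \<bullet> T' = 0"
    by (simp add: T' ct(1) inner_diff_right dot_cross_self sgn_div_norm)
  then have "vderiv (binormal \<gamma>) t \<bullet> T' = (cross3 a d \<bullet> T') / norm (c t)"
    by (simp add: B' inner_diff_left sgn_div_norm divide_inverse mult.commute)
  also have "cross3 a d \<bullet> T' = - (c t \<bullet> d) / norm a"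
    by (simp add: T' inner_diff_right sgn_div_norm dot_cross_self ct(1) triple_product_swap[of a d b] divide_inverse mult.commute)
  finally have BT: "vderiv (binormal \<gamma>) t \<bullet> T' = - (c t \<bullet> d) / norm a / norm (c t)" .
  have "torsion \<gamma> t * norm a = - (vderiv (binormal \<gamma>) t \<bullet> sgn T')"
    using a by (simp add: torsion_def arc_deriv_def principal_normal_def sgn_scaleR flip: abd)
  also have "\<dots> = - (vderiv (binormal \<gamma>) t \<bullet> T') / norm T'"
    by (simp add: sgn_div_norm divide_inverse mult.commute)
  also have "\<dots> = norm a * (c t \<bullet> d) / (norm (c t))\<^sup>2"
    using a ct(2) by (simp add: BT nT' power2_eq_square)
  finally show ?thesis by (simp only: abd)
qed

lemma total_curvature_torsion_eq:
  fixes \<gamma> :: "real \<Rightarrow> real^3"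
  assumes sm: "smooth_curve \<gamma>" and nz: "\<And>t. cross3 (vderiv \<gamma> t) (vderiv (vderiv \<gamma>) t) \<noteq> 0"
  defines "c \<equiv> \<lambda>t. cross3 (vderiv \<gamma> t) (vderiv (vderiv \<gamma>) t)"
  shows "total_curvature_torsion \<gamma> = integral {0..1} (\<lambda>t. norm (c t) / (norm (vderiv \<gamma> t))\<^sup>2 +
      norm (vderiv \<gamma> t) * \<bar>c t \<bullet> vderiv (vderiv (vderiv \<gamma>)) t\<bar> / (norm (c t))\<^sup>2)"
proof -
  have "(curvature \<gamma> t + \<bar>torsion \<gamma> t\<bar>) * norm (vderiv \<gamma> t) = norm (c t) / (norm (vderiv \<gamma> t))\<^sup>2 +
      norm (vderiv \<gamma> t) * \<bar>c t \<bullet> vderiv (vderiv (vderiv \<gamma>)) t\<bar> / (norm (c t))\<^sup>2" for t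
  proof -
    have "\<bar>torsion \<gamma> t\<bar> * norm (vderiv \<gamma> t) = \<bar>torsion \<gamma> t * norm (vderiv \<gamma> t)\<bar>"
      by (simp add: abs_mult)
    then show ?thesis
      unfolding torsion_times_speed[OF sm nz] distrib_right curvature_times_speed[OF sm nz]
      by (simp add: abs_mult c_def)
  qed
  then show ?thesis by (simp add: total_curvature_torsion_def)
qed

section \<open>Removing inflection points\<close>

lemma vderiv_scaleR:
  assumes "smooth_curve f" "smooth_curve g"
  shows "vderiv (\<lambda>t. f t *\<^sub>R g t) = (\<lambda>t. f t *\<^sub>R vderiv g t + vderiv f t *\<^sub>R g t)"
  using has_vector_derivative_scaleR[of f "vderiv f t" t UNIV g "vderiv g t" for t]
    assms[THEN smooth_curve_has_vector_derivative]
  by (intro vderiv_eqI) (simp add: has_real_derivative_iff_has_vector_derivative)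

lemma vderiv_add:
  assumes "smooth_curve f" "smooth_curve g"
  shows "vderiv (\<lambda>t. f t + g t) = (\<lambda>t. vderiv f t + vderiv g t)"
  by (intro vderiv_eqI has_vector_derivative_add smooth_curve_has_vector_derivative assms)

lemma vderiv_bounded_linear:
  assumes "bounded_linear L" "smooth_curve f"
  shows "vderiv (\<lambda>t. L (f t)) = (\<lambda>t. L (vderiv f t))"
  by (intro vderiv_eqI bounded_linear.has_vector_derivative[OF assms(1)] smooth_curve_has_vector_derivative assms)

text \<open>The function is the product of the factors 1 - cos (2\<pi>(t - z)) over z in Z. Each has
  a double zero at z and is positive elsewhere in the period.\<close>

lemma second_order_zeros_function:
  fixes Z :: "real set"
  assumes "finite Z" "Z \<subseteq> {0..<1}"
  obtains f where "smooth_curve f" "\<And>t. f (t + 1) = f t"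
    "\<And>t. t \<in> Z \<Longrightarrow> f t = 0 \<and> vderiv f t = 0 \<and> vderiv (vderiv f) t > (0::real)"
proof -
  \<comment> \<open>Positivity off Z is carried through the induction because the second derivative
    at a new zero z is a positive multiple of the old f z.\<close>
  have "\<exists>f. smooth_curve f \<and> (\<forall>t. f (t + 1) = f t) \<and>
     (\<forall>t\<in>Z. f t = 0 \<and> vderiv f t = 0 \<and> vderiv (vderiv f) t > (0::real)) \<and> (\<forall>t\<in>{0..<1} - Z. f t > 0)"
    using assms
  proof (induction Z)
    case empty
    then show ?case by (intro exI[of _ "\<lambda>t. 1"]) (auto intro: smooth_curve_const)
  next
    case (insert z Z)
    then obtain f :: "real \<Rightarrow> real" where f0: "smooth_curve f" "\<forall>t. f (t + 1) = f t"
      "\<forall>t\<in>Z. f t = 0 \<and> vderiv f t = 0 \<and> vderiv (vderiv f) t > 0"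
      "\<forall>t\<in>{0..<1} - Z. f t > 0" by blast
    note f = f0(1) f0(2)[rule_format] f0(3)[rule_format] f0(4)[rule_format]
    define k :: real where "k = 2 * pi"
    define g where "g = (\<lambda>t. 1 + (-1) *\<^sub>R cos (k * t + (- (k * z))))"
    have g: "smooth_curve g"
      unfolding g_def
      by (intro smooth_curve_add smooth_curve_scaleR smooth_curve_const smooth_curve_cos_shift)
    have g': "vderiv g = (\<lambda>t. k * sin (k * t + (- (k * z))))"
      unfolding g_def
      by (intro vderiv_eqI) (auto simp: has_real_derivative_iff_has_vector_derivative[symmetric]
         intro!: derivative_eq_intros)
    have g'': "vderiv (vderiv g) = (\<lambda>t. k * (k * cos (k * t + (- (k * z)))))"
      unfolding g'
      by (intro vderiv_eqI) (auto simp: has_real_derivative_iff_has_vector_derivative[symmetric]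
         intro!: derivative_eq_intros)
    have gz: "g z = 0" "vderiv g z = 0" "vderiv (vderiv g) z > 0"
      by (simp add: g_def, simp add: g', simp add: g'' k_def)
    have gpos: "g t > 0" if "t \<in> {0..<1}" "t \<noteq> z" for t
    proof -
      have "cos (k * (t - z)) \<noteq> 1"
      proof
        assume "cos (k * (t - z)) = 1"
        then obtain m :: int where "k * (t - z) = m * 2 * pi" using cos_one_2pi_int by auto
        then have "t - z = m" by (simp add: k_def)
        moreover have "\<bar>t - z\<bar> < 1" using that insert.prems by (auto simp: abs_less_iff)
        ultimately have "m = 0" by linarith
        then show False using that \<open>t - z = m\<close> by simp
      qed
      then have "cos (k * (t - z)) < 1" using cos_le_one[of "k * (t - z)"] by linarith
      then show ?thesis by (simp add: g_def algebra_simps)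
    qed
    have gper: "g (t + 1) = g t" for t
    proof -
      have "k * (t + 1) + (- (k * z)) = (k * t + (- (k * z))) + 2 * pi" by (simp add: k_def algebra_simps)
      then show ?thesis unfolding g_def by (simp only: cos_periodic)
    qed
    have fg': "vderiv (\<lambda>t. f t *\<^sub>R g t) = (\<lambda>t. f t *\<^sub>R vderiv g t + vderiv f t *\<^sub>R g t)"
      by (rule vderiv_scaleR[OF f(1) g])
    have fg'': "vderiv (vderiv (\<lambda>t. f t *\<^sub>R g t)) = (\<lambda>t. (f t *\<^sub>R vderiv (vderiv g) t + vderiv f t *\<^sub>R vderiv g t) +
        (vderiv f t *\<^sub>R vderiv g t + vderiv (vderiv f) t *\<^sub>R g t))"
      unfolding fg'
      by (simp only: vderiv_add vderiv_scaleR smooth_curve_scaleR smooth_curve_vderiv f(1) g)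
    show ?case
    proof (intro exI[of _ "\<lambda>t. f t *\<^sub>R g t"] conjI allI ballI)
      show "smooth_curve (\<lambda>t. f t *\<^sub>R g t)" by (rule smooth_curve_scaleR[OF f(1) g])
      show "f (t + 1) *\<^sub>R g (t + 1) = f t *\<^sub>R g t" for t by (simp add: f(2) gper)
      fix t assume t: "t \<in> insert z Z"
      show "f t *\<^sub>R g t = 0" using t f(3) gz by auto
      show "vderiv (\<lambda>t. f t *\<^sub>R g t) t = 0" unfolding fg' using t f(3) gz by auto
      \<comment> \<open>Of the Leibniz terms only f g'' survives at the new zero, and only f'' g at
        an old one.\<close>
      show "vderiv (vderiv (\<lambda>t. f t *\<^sub>R g t)) t > 0"
      proof (cases "t = z")
        case True
        then show ?thesis unfolding fg'' using gz f(4)[of z] insert by simp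
      next
        case False
        then show ?thesis unfolding fg'' using f(3)[of t] gpos[of t] t insert.prems by auto
      qed
    next
      fix t assume "t \<in> {0..<1} - insert z Z"
      then show "f t *\<^sub>R g t > 0" using f(4)[of t] gpos[of t] by simp
    qed
  qed
  then show ?thesis using that by blast
qed

text \<open>Infinitely many zeros would accumulate in the compact interval, and by continuity the
  accumulation point would be a zero that is not isolated.\<close>

lemma finite_isolated_zeros:
  fixes W :: "real \<Rightarrow> real"
  assumes cont: "continuous_on UNIV W" and iso: "\<And>t. W t = 0 \<Longrightarrow> \<forall>\<^sub>F s in at t. W s \<noteq> 0"
  shows "finite {t \<in> {0..1}. W t = 0}"
proof (rule ccontr)
  assume "infinite {t \<in> {0..1}. W t = 0}"
  then obtain x where x: "x islimpt {t \<in> {0..1}. W t = 0}"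
    using compact_eq_Bolzano_Weierstrass[of "{0..1::real}"] by (metis (no_types, lifting) compact_Icc mem_Collect_eq subsetI)
  then have fr: "\<exists>\<^sub>F s in at x. W s = 0"
    unfolding islimpt_iff_eventually frequently_def by (auto elim!: contrapos_nn eventually_mono)
  have "closed {t. W t = 0}" using continuous_closed_preimage_constant[OF cont closed_UNIV, of 0] by simp
  moreover have "x islimpt {t. W t = 0}" using x by (rule islimpt_subset) auto
  ultimately have "W x = 0" by (auto simp: closed_limpt)
  then show False using iso fr by (auto simp: frequently_def)
qed

text \<open>The maximum of W and L is positive, so by compactness it has a positive lower bound.
  Where W attains this bound the other terms are too small to matter; where L does, the linear term
  beats the quadratic one.\<close>

lemma positive_perturbation:
  fixes W L M :: "real \<Rightarrow> real"
  assumes per: "\<And>t. W (t + 1) = W t" "\<And>t. L (t + 1) = L t" "\<And>t. M (t + 1) = M t"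
    and cont: "continuous_on UNIV W" "continuous_on UNIV L" "continuous_on UNIV M"
    and W: "\<And>t. W t \<ge> 0" and L: "\<And>t. t \<in> {0..<1} \<Longrightarrow> W t = 0 \<Longrightarrow> L t > 0"
  obtains d1 where "d1 > 0" "\<And>d t. 0 < d \<Longrightarrow> d < d1 \<Longrightarrow> W t + d * L t + d\<^sup>2 * M t > 0"
proof -
  define m where "m = (\<lambda>t. max (W t) (L t))"
  have m_frac: "m (frac t) = m t" for t
    by (rule periodic_frac) (simp add: m_def per)
  have m_pos: "m t > 0" for t
  proof -
    have "m (frac t) > 0"
    proof (cases "W (frac t) = 0")
      case True
      then show ?thesis using L[of "frac t"] by (simp add: m_def less_max_iff_disj frac_lt_1)
    next
      case False
      then have "W (frac t) > 0" using W[of "frac t"] by simp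
      then show ?thesis by (simp add: m_def less_max_iff_disj)
    qed
    then show ?thesis by (simp add: m_frac)
  qed
  have "continuous_on {0..1} m"
    unfolding m_def using cont by (intro continuous_intros) (auto intro: continuous_on_subset)
  then obtain z where z: "\<forall>t\<in>{0..1}. m z \<le> m t"
    using continuous_attains_inf[of "{0..1}" m] by auto
  have mz: "m z \<le> m t" for t
    using bspec[OF z, of "frac t"] frac_ge_0[of t] frac_lt_1[of t] by (simp add: m_frac less_imp_le)
  obtain B1 where B1: "B1 > 0" "\<And>t. norm (L t) \<le> B1"
    using periodic_continuous_bounded[OF per(2) cont(2)] by blast
  obtain B2 where B2: "B2 > 0" "\<And>t. norm (M t) \<le> B2"
    using periodic_continuous_bounded[OF per(3) cont(3)] by blast
  define B where "B = B1 + B2"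
  have B: "B > 0" "\<And>t. \<bar>L t\<bar> \<le> B" "\<And>t. \<bar>M t\<bar> \<le> B"
    using B1 B2 by (auto simp: B_def intro: order_trans add_increasing add_increasing2 less_imp_le)
  show ?thesis
  \<comment> \<open>With d < 1 both the linear and the quadratic term are at most d * B in size, so
    together they stay below m z.\<close>
  proof (rule that[of "min 1 (m z / (2 * B))"])
    show "min 1 (m z / (2 * B)) > 0" using m_pos B(1) by simp
    fix d t :: real assume "0 < d" "d < min 1 (m z / (2 * B))"
    then have d: "0 < d" "d < 1" "2 * (d * B) < m z" using B(1) by (auto simp: field_simps)
    have dM: "\<bar>d * M t\<bar> \<le> d * B" and dL: "\<bar>d * L t\<bar> \<le> d * B"
      using d(1) B by (auto simp: abs_mult)
    have ddM: "\<bar>d * (d * M t)\<bar> \<le> d * B"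
      using dM d mult_left_le_one_le[of "\<bar>d * M t\<bar>" d] by (simp add: abs_mult)
    have dB: "d * B > 0" using d B by simp
    consider "m z \<le> W t" | "m z \<le> L t" using mz[of t] by (auto simp: m_def le_max_iff_disj)
    then have "W t + d * L t + d * (d * M t) > 0"
    proof cases
      case 1
      then show ?thesis using dL ddM d(3) by linarith
    next
      case 2
      have "L t + d * M t > 0" using 2 dM d(3) dB by linarith
      then have "d * (L t + d * M t) > 0" using d(1) by simp
      then show ?thesis using W[of t] by (simp add: distrib_left)
    qed
    then show "W t + d * L t + d\<^sup>2 * M t > 0" by (simp add: power2_eq_square)
  qed
qed

text \<open>The integral is continuous up to the endpoint 0, where the bound need not be available
  directly: it serves for e = 0, where the curve is flat, and for d = 0, where inflection points
  return.\<close>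

lemma parameter_limit:
  fixes g :: "real \<Rightarrow> real \<Rightarrow> real" and k :: ereal
  assumes b: "b > 0" and cont: "continuous_on ({0..b} \<times> {0..1}) (\<lambda>(x, t). g x t)"
    and le: "\<And>x. 0 < x \<Longrightarrow> x < b \<Longrightarrow> k \<le> ereal (integral {0..1} (g x))"
  shows "k \<le> ereal (integral {0..1} (g 0))"
proof -
  have "continuous_on {0..b} (\<lambda>x. integral (cbox 0 1) (g x))"
    using cont by (intro integral_continuous_on_param) simp
  then have "((\<lambda>x. integral {0..1} (g x)) \<longlongrightarrow> integral {0..1} (g 0)) (at 0 within {0..b})"
    using b by (auto simp: continuous_on_def)
  then have "((\<lambda>x. integral {0..1} (g x)) \<longlongrightarrow> integral {0..1} (g 0)) (at_right 0)"
    using b at_within_Icc_at_right by metis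
  then have "((\<lambda>x. ereal (integral {0..1} (g x))) \<longlongrightarrow> ereal (integral {0..1} (g 0))) (at_right 0)"
    by (intro tendsto_intros)
  moreover have "\<forall>\<^sub>F x in at_right 0. k \<le> ereal (integral {0..1} (g x))"
    using eventually_at_right_real[OF b] by eventually_elim (use le in auto)
  ultimately show ?thesis
    by (rule tendsto_lowerbound) simp
qed

section \<open>Cross products of squashed and of projected vectors\<close>

text \<open>The \<open>w\<close>-component of a cross product is the signed area spanned by the
  projections to the plane, which squashing leaves alone. Hence the planar determinant is
  independent of \<open>e\<close>.\<close>

lemma squash_cross_inner:
  assumes "norm w = 1"
  shows "cross3 (squash w e a) (squash w e b) \<bullet> w = cross3 a b \<bullet> w"
  by (simp add: squash_def cross_add_left cross_add_right cross_mult_left cross_mult_right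
      inner_add_left dot_cross_self)

lemma squash_0_inner: "norm w = 1 \<Longrightarrow> squash w 0 x \<bullet> w = 0"
  by (simp add: squash_def inner_diff_left norm_eq_1)

text \<open>Both factors lie in the plane orthogonal to \<open>w\<close>, so their product is
  parallel to \<open>w\<close>.\<close>

lemma squash_0_cross:
  assumes w: "norm w = 1"
  shows "cross3 (squash w 0 a) (squash w 0 b) = (cross3 a b \<bullet> w) *\<^sub>R w"
proof -
  let ?z = "cross3 (squash w 0 a) (squash w 0 b)"
  have "cross3 w ?z = 0"
    using squash_0_inner[OF w] by (simp add: Lagrange inner_commute)
  moreover have "cross3 w (cross3 w ?z) = (?z \<bullet> w) *\<^sub>R w - ?z"
    unfolding Lagrange[of w w ?z] using w by (simp add: inner_commute norm_eq_1)
  ultimately show ?thesis by (simp add: squash_cross_inner[OF w])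
qed

lemma norm_squash_0:
  assumes "norm w = 1"
  shows "(norm (squash w 0 x))\<^sup>2 = (norm x)\<^sup>2 - (x \<bullet> w)\<^sup>2"
proof -
  have "w \<bullet> w = 1" using assms by (simp add: norm_eq_1)
  then show ?thesis
    unfolding power2_norm_eq_inner unfolding squash_def power2_eq_square
    by (simp add: inner_diff_left inner_diff_right inner_commute)
qed

text \<open>The vector w \<times> a is the projection of a turned by a right angle, and the two span
  a square. This area is the first-order gain in planar curvature.\<close>

lemma cross_rotated_inner:
  assumes "norm w = 1"
  shows "cross3 a (cross3 w a) \<bullet> w = (norm (squash w 0 a))\<^sup>2"
proof -
  have "w \<bullet> w = 1" using assms by (simp add: norm_eq_1)
  then show ?thesis
    unfolding norm_squash_0[OF assms] unfolding power2_norm_eq_inner unfolding Lagrange power2_eq_square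
    by (simp add: inner_diff_left inner_diff_right inner_commute)
qed

text \<open>The curves are arbitrary arguments because the operation is linear in them: each
  derivative of a perturbed lift is the perturbed lift of the derivatives.\<close>

definition perturbed_lift ::
    "real^3 \<Rightarrow> (real \<Rightarrow> real^3) \<Rightarrow> (real \<Rightarrow> real^3) \<Rightarrow> real \<Rightarrow> real \<Rightarrow> real \<Rightarrow> real^3" where
  "perturbed_lift w \<gamma> q d e t = squash w e (\<gamma> t + d *\<^sub>R q t)"

lemma smooth_curve_perturbed_lift:
  assumes "smooth_curve \<gamma>" "smooth_curve q"
  shows "smooth_curve (perturbed_lift w \<gamma> q d e)"
  unfolding perturbed_lift_def[abs_def]
  by (intro smooth_curve_bounded_linear[OF bounded_linear_squash] smooth_curve_add assms
      smooth_curve_scaleR smooth_curve_const)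

lemma vderiv_perturbed_lift:
  assumes "smooth_curve \<gamma>" "smooth_curve q"
  shows "vderiv (perturbed_lift w \<gamma> q d e) = perturbed_lift w (vderiv \<gamma>) (vderiv q) d e"
  unfolding perturbed_lift_def[abs_def]
  by (simp only: vderiv_bounded_linear[OF bounded_linear_squash] vderiv_add smooth_curve_add assms
      smooth_curve_scaleR smooth_curve_const vderiv_bounded_linear[OF bounded_linear_scaleR_right])

lemma continuous_on_perturbed_lift:
  assumes "smooth_curve \<gamma>" "smooth_curve q"
    "continuous_on S d" "continuous_on S e" "continuous_on S t"
  shows "continuous_on S (\<lambda>z. perturbed_lift w \<gamma> q (d z) (e z) (t z))"
  unfolding perturbed_lift_def squash_def
  using assms(3-)
  by (intro continuous_intros continuous_on_compose2[OF smooth_curve_continuous[OF assms(1), of UNIV]]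
      continuous_on_compose2[OF smooth_curve_continuous[OF assms(2), of UNIV]]) auto

text \<open>The lift is reached from K by three successive isotopies: to \<gamma>, to the perturbed
  curve, to its squashed image. The nonzero cross product supplies both immersion and nonvanishing
  curvature.\<close>

lemma kappa_tau_le_perturbed_lift:
  assumes \<gamma>: "conformation \<gamma> K" and q: "smooth_curve q" "\<And>t. q (t + 1) = q t"
    and w: "norm w = 1" and e: "e > 0"
    and iso: "inj_on (\<lambda>t. \<gamma> t + d *\<^sub>R q t) {0..<1}"
      "ambient_isotopic (range \<gamma>) (range (\<lambda>t. \<gamma> t + d *\<^sub>R q t))"
    and nz: "\<And>t. cross3 (vderiv (perturbed_lift w \<gamma> q d e) t) (vderiv (vderiv (perturbed_lift w \<gamma> q d e)) t) \<noteq> 0"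
  shows "kappa_tau K \<le> ereal (total_curvature_torsion (perturbed_lift w \<gamma> q d e))"
proof -
  let ?\<eta> = "perturbed_lift w \<gamma> q d e"
  have sm: "smooth_curve \<gamma>" and per: "\<And>t. \<gamma> (t + 1) = \<gamma> t" and K: "ambient_isotopic K (range \<gamma>)"
    using \<gamma> by (auto simp: conformation_def smooth_simple_closed_curve_def smooth_immersed_closed_curve_def)
  have sm\<eta>: "smooth_curve ?\<eta>" by (rule smooth_curve_perturbed_lift[OF sm q(1)])
  have nz1: "vderiv ?\<eta> t \<noteq> 0" for t using nz[of t] by auto
  have "inj (squash w e)"
    using homeomorphism_squash[OF w, of e] e by (metis homeomorphism_apply1 inj_on_inverseI less_irrefl)
  then have "inj_on ?\<eta> {0..<1}"
    using iso(1) by (auto simp: inj_on_def perturbed_lift_def)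
  then have simple: "smooth_simple_closed_curve ?\<eta>"
    unfolding smooth_simple_closed_curve_def smooth_immersed_closed_curve_def
    using sm\<eta> nz1 by (simp add: perturbed_lift_def per q(2))
  have "range ?\<eta> = squash w e ` range (\<lambda>t. \<gamma> t + d *\<^sub>R q t)"
    by (auto simp: perturbed_lift_def)
  then have "ambient_isotopic K (range ?\<eta>)"
    using ambient_isotopic_trans[OF K ambient_isotopic_trans[OF iso(2) ambient_isotopic_squash[OF w e]]] by simp
  moreover have "curvature ?\<eta> t \<noteq> 0" for t
    using curvature_times_speed[OF sm\<eta> nz[of t]] nz[of t] nz1[of t] by auto
  ultimately show ?thesis
    unfolding kappa_tau_def using simple by (intro Inf_lower) (auto simp: conformation_def)
qed

text \<open>Along \<gamma> + d q the planar determinant is W + d L + d^2 M. Where W, and so f and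
  f', vanish, q' is 0 and q'' is f'' n, so L reduces to f'' times the squared speed of the
  projection.\<close>

lemma curvature_correction:
  fixes \<gamma> :: "real \<Rightarrow> real^3"
  assumes sm: "smooth_curve \<gamma>" and per: "\<And>t. \<gamma> (t + 1) = \<gamma> t" and w: "norm w = 1"
    and W_def: "\<And>t. W t = cross3 (vderiv \<gamma> t) (vderiv (vderiv \<gamma>) t) \<bullet> w"
    and W: "\<And>t. W t \<ge> 0" and iso: "\<And>t. W t = 0 \<Longrightarrow> \<forall>\<^sub>F s in at t. W s \<noteq> 0"
    and nz: "\<And>t. squash w 0 (vderiv \<gamma> t) \<noteq> 0"
  obtains q d1 where "smooth_curve q" "\<And>t. q (t + 1) = q t" "d1 > 0"
    "\<And>d t. 0 < d \<Longrightarrow> d < d1 \<Longrightarrow>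
      cross3 (vderiv \<gamma> t + d *\<^sub>R vderiv q t) (vderiv (vderiv \<gamma>) t + d *\<^sub>R vderiv (vderiv q) t) \<bullet> w > 0"
proof -
  note sm' = smooth_curve_vderiv[OF sm]
  note sm'' = smooth_curve_vderiv[OF sm']
  note per' = periodic_vderiv[OF sm per]
  note per'' = periodic_vderiv[OF sm' per']
  have contW: "continuous_on UNIV W"
    unfolding W_def by (intro continuous_intros continuous_on_cross smooth_curve_continuous sm' sm'')
  have "finite {t \<in> {0..<1}. W t = 0}"
    by (rule finite_subset[OF _ finite_isolated_zeros[OF contW iso]]) auto
  then obtain f where f: "smooth_curve f" "\<And>t. f (t + 1) = f t"
    "\<And>t. t \<in> {t \<in> {0..<1}. W t = 0} \<Longrightarrow> f t = 0 \<and> vderiv f t = 0 \<and> vderiv (vderiv f) t > (0::real)"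
    using second_order_zeros_function[of "{t \<in> {0..<1}. W t = 0}"] by (metis (no_types, lifting) mem_Collect_eq subsetI)
  have Lw: "bounded_linear (cross3 w)"
    by (rule bounded_bilinear.bounded_linear_right[OF bounded_bilinear_cross3])
  define n where "n = (\<lambda>t. cross3 w (vderiv \<gamma> t))"
  have n: "smooth_curve n" unfolding n_def by (rule smooth_curve_bounded_linear[OF Lw sm'])
  define q where "q = (\<lambda>t. f t *\<^sub>R n t)"
  have q: "smooth_curve q" unfolding q_def by (rule smooth_curve_scaleR[OF f(1) n])
  have q': "vderiv q = (\<lambda>t. f t *\<^sub>R vderiv n t + vderiv f t *\<^sub>R n t)"
    unfolding q_def by (rule vderiv_scaleR[OF f(1) n])
  have q'': "vderiv (vderiv q) = (\<lambda>t. (f t *\<^sub>R vderiv (vderiv n) t + vderiv f t *\<^sub>R vderiv n t) +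
        (vderiv f t *\<^sub>R vderiv n t + vderiv (vderiv f) t *\<^sub>R n t))"
    unfolding q' by (simp only: vderiv_add vderiv_scaleR smooth_curve_scaleR smooth_curve_vderiv f(1) n)
  have perq: "q (t + 1) = q t" for t by (simp add: q_def n_def f(2) per')
  note perq' = periodic_vderiv[OF q perq]
  note perq'' = periodic_vderiv[OF smooth_curve_vderiv[OF q] perq']
  define L where "L = (\<lambda>t. (cross3 (vderiv \<gamma> t) (vderiv (vderiv q) t) + cross3 (vderiv q t) (vderiv (vderiv \<gamma>) t)) \<bullet> w)"
  define M where "M = (\<lambda>t. cross3 (vderiv q t) (vderiv (vderiv q) t) \<bullet> w)"
  have contL: "continuous_on UNIV L" and contM: "continuous_on UNIV M"
    unfolding L_def M_def
    by (intro continuous_intros continuous_on_cross smooth_curve_continuous sm' sm'' smooth_curve_vderiv q)+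
  have L: "L t > 0" if t: "t \<in> {0..<1}" "W t = 0" for t
  proof -
    have ft: "f t = 0" "vderiv f t = 0" "vderiv (vderiv f) t > 0" using f(3) t by auto
    have "cross3 (vderiv \<gamma> t) (n t) \<bullet> w = (norm (squash w 0 (vderiv \<gamma> t)))\<^sup>2"
      unfolding n_def by (rule cross_rotated_inner[OF w])
    then have "L t = vderiv (vderiv f) t * (norm (squash w 0 (vderiv \<gamma> t)))\<^sup>2"
      by (simp add: L_def fun_cong[OF q', of t] fun_cong[OF q'', of t] ft cross_mult_right)
    then show ?thesis using ft(3) nz[of t] by simp
  qed
  have perW: "W (t + 1) = W t" and perL: "L (t + 1) = L t" and perM: "M (t + 1) = M t" for t
    by (simp_all add: W_def L_def M_def per' per'' perq' perq'')
  obtain d1 where d1: "d1 > 0" "\<And>d t. 0 < d \<Longrightarrow> d < d1 \<Longrightarrow> W t + d * L t + d\<^sup>2 * M t > 0"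
    using positive_perturbation[OF perW perL perM contW contL contM W L] by blast
  show ?thesis
  proof (rule that[OF q perq d1(1)])
    fix d t :: real assume "0 < d" "d < d1"
    then have "W t + d * L t + d\<^sup>2 * M t > 0" by (rule d1(2))
    also have "W t + d * L t + d\<^sup>2 * M t =
      cross3 (vderiv \<gamma> t + d *\<^sub>R vderiv q t) (vderiv (vderiv \<gamma>) t + d *\<^sub>R vderiv (vderiv q) t) \<bullet> w"
      by (simp add: W_def L_def M_def cross_add_left cross_add_right cross_mult_left cross_mult_right
          inner_add_left power2_eq_square algebra_simps)
    finally show "\<dots> > 0" .
  qed
qed

section \<open>The flat limit\<close>

lemma perturbed_lift_bound:
  fixes \<gamma> q :: "real \<Rightarrow> real^3"
  assumes \<gamma>: "conformation \<gamma> K" and q: "smooth_curve q" "\<And>t. q (t + 1) = q t"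
    and w: "norm w = 1"
    and iso: "inj_on (\<lambda>t. \<gamma> t + d *\<^sub>R q t) {0..<1}"
      "ambient_isotopic (range \<gamma>) (range (\<lambda>t. \<gamma> t + d *\<^sub>R q t))"
    and pos: "\<And>t. cross3 (vderiv \<gamma> t + d *\<^sub>R vderiv q t)
      (vderiv (vderiv \<gamma>) t + d *\<^sub>R vderiv (vderiv q) t) \<bullet> w > 0"
  shows "kappa_tau K \<le> ereal (integral {0..1} (\<lambda>t.
     (cross3 (vderiv \<gamma> t + d *\<^sub>R vderiv q t) (vderiv (vderiv \<gamma>) t + d *\<^sub>R vderiv (vderiv q) t) \<bullet> w) /
      (norm (squash w 0 (vderiv \<gamma> t + d *\<^sub>R vderiv q t)))\<^sup>2))"
proof -
  have sm: "smooth_curve \<gamma>"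
    using \<gamma> by (auto simp: conformation_def smooth_simple_closed_curve_def smooth_immersed_closed_curve_def)
  note sm' = smooth_curve_vderiv[OF sm] and q' = smooth_curve_vderiv[OF q(1)]
  note sm'' = smooth_curve_vderiv[OF sm'] and q'' = smooth_curve_vderiv[OF q']
  note sm''' = smooth_curve_vderiv[OF sm''] and q''' = smooth_curve_vderiv[OF q'']
  let ?v = "\<lambda>e. perturbed_lift w (vderiv \<gamma>) (vderiv q) d e"
  let ?a = "\<lambda>e. perturbed_lift w (vderiv (vderiv \<gamma>)) (vderiv (vderiv q)) d e"
  let ?j = "\<lambda>e. perturbed_lift w (vderiv (vderiv (vderiv \<gamma>))) (vderiv (vderiv (vderiv q))) d e"
  define c where "c = (\<lambda>e t. cross3 (?v e t) (?a e t))"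
  define g where "g = (\<lambda>e t. norm (c e t) / (norm (?v e t))\<^sup>2 + norm (?v e t) * \<bar>c e t \<bullet> ?j e t\<bar> / (norm (c e t))\<^sup>2)"
  \<comment> \<open>The value does not depend on \<open>e\<close>, so the cross product stays
    nonzero at e = 0 and the integrand is continuous there, torsion included.\<close>
  have cw: "c e t \<bullet> w > 0" for e t
    unfolding c_def perturbed_lift_def squash_cross_inner[OF w] by (rule pos)
  then have c0: "c e t \<noteq> 0" for e t by (metis inner_zero_left less_irrefl)
  then have v0: "?v e t \<noteq> 0" for e t by (metis c_def cross_zero_left)
  have bound: "kappa_tau K \<le> ereal (integral {0..1} (g e))" if "0 < e" for e
  proof -
    let ?\<eta> = "perturbed_lift w \<gamma> q d e"
    have v: "vderiv ?\<eta> = ?v e" "vderiv (?v e) = ?a e" "vderiv (?a e) = ?j e"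
      by (simp_all only: vderiv_perturbed_lift sm sm' sm'' q(1) q' q'')
    have nz: "cross3 (vderiv ?\<eta> t) (vderiv (vderiv ?\<eta>) t) \<noteq> 0" for t
      unfolding v using c0 by (simp add: c_def)
    have "total_curvature_torsion ?\<eta> = integral {0..1} (g e)"
      unfolding total_curvature_torsion_eq[OF smooth_curve_perturbed_lift[OF sm q(1)] nz] v g_def c_def ..
    then show ?thesis
      using kappa_tau_le_perturbed_lift[OF \<gamma> q w that iso nz] by simp
  qed
  have cont: "continuous_on ({0..1} \<times> {0..1}) (\<lambda>(e, t). g e t)"
  proof -
    have "continuous_on A (\<lambda>z. c (fst z) (snd z))" for A :: "(real \<times> real) set"
      unfolding c_def
      by (intro continuous_intros continuous_on_cross continuous_on_perturbed_lift sm' sm'' q' q'')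
    then show ?thesis
      unfolding split_beta g_def
      by (intro continuous_intros continuous_on_perturbed_lift sm' sm''' q' q''') (simp_all add: c0 v0)
  qed
  have "kappa_tau K \<le> ereal (integral {0..1} (g 0))"
    by (rule parameter_limit[OF zero_less_one cont bound])
  moreover have "integral {0..1} (g 0) = integral {0..1} (\<lambda>t. (cross3 (vderiv \<gamma> t + d *\<^sub>R vderiv q t) (vderiv (vderiv \<gamma>) t + d *\<^sub>R vderiv (vderiv q) t) \<bullet> w) /
      (norm (squash w 0 (vderiv \<gamma> t + d *\<^sub>R vderiv q t)))\<^sup>2)"
  proof (rule integral_cong)
    fix t
    \<comment> \<open>At e = 0 the cross product points along \<open>w\<close> while the third
      derivative lies in the plane: the torsion term is 0, and the norm of the cross product is its
      positive \<open>w\<close>-component.\<close>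
    have j: "?j 0 t \<bullet> w = 0" unfolding perturbed_lift_def by (rule squash_0_inner[OF w])
    have c: "c 0 t = (c 0 t \<bullet> w) *\<^sub>R w"
      unfolding c_def perturbed_lift_def squash_0_cross[OF w] using w by (simp add: norm_eq_1)
    have "c 0 t \<bullet> ?j 0 t = 0"
      by (subst c) (simp add: j inner_commute[of w])
    moreover have "norm (c 0 t) = c 0 t \<bullet> w"
      using arg_cong[OF c, of norm] cw[of 0 t] w by (simp only: norm_scaleR abs_of_pos mult_1_right)
    moreover have "c 0 t \<bullet> w = cross3 (vderiv \<gamma> t + d *\<^sub>R vderiv q t) (vderiv (vderiv \<gamma>) t + d *\<^sub>R vderiv (vderiv q) t) \<bullet> w"
      unfolding c_def perturbed_lift_def squash_cross_inner[OF w] ..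
    ultimately show "g 0 t = (cross3 (vderiv \<gamma> t + d *\<^sub>R vderiv q t) (vderiv (vderiv \<gamma>) t + d *\<^sub>R vderiv (vderiv q) t) \<bullet> w) /
      (norm (squash w 0 (vderiv \<gamma> t + d *\<^sub>R vderiv q t)))\<^sup>2"
      by (simp add: g_def perturbed_lift_def)
  qed
  ultimately show ?thesis by simp
qed

lemma kappa_tau_le_turning:
  fixes \<gamma> :: "real \<Rightarrow> real^3"
  assumes \<gamma>: "conformation \<gamma> K" and w: "norm w = 1"
    and W_def: "\<And>t. W t = cross3 (vderiv \<gamma> t) (vderiv (vderiv \<gamma>) t) \<bullet> w"
    and W: "\<And>t. W t \<ge> 0" and iso: "\<And>t. W t = 0 \<Longrightarrow> \<forall>\<^sub>F s in at t. W s \<noteq> 0"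
    and nz: "\<And>t. squash w 0 (vderiv \<gamma> t) \<noteq> 0"
  shows "kappa_tau K \<le> ereal (integral {0..1} (\<lambda>t. W t / (norm (squash w 0 (vderiv \<gamma> t)))\<^sup>2))"
proof -
  have simple: "smooth_simple_closed_curve \<gamma>" and sm: "smooth_curve \<gamma>" and per: "\<And>t. \<gamma> (t + 1) = \<gamma> t"
    using \<gamma> by (auto simp: conformation_def smooth_simple_closed_curve_def smooth_immersed_closed_curve_def)
  obtain q d1 where q: "smooth_curve q" "\<And>t. q (t + 1) = q t" and d1: "d1 > 0"
    "\<And>d t. 0 < d \<Longrightarrow> d < d1 \<Longrightarrow>
      cross3 (vderiv \<gamma> t + d *\<^sub>R vderiv q t) (vderiv (vderiv \<gamma>) t + d *\<^sub>R vderiv (vderiv q) t) \<bullet> w > 0"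
    using curvature_correction[OF sm per w W_def W iso nz] by blast
  obtain d0 where d0: "d0 > 0"
    "\<And>d. 0 < d \<Longrightarrow> d < d0 \<Longrightarrow> inj_on (\<lambda>t. \<gamma> t + d *\<^sub>R q t) {0..<1} \<and>
       ambient_isotopic (range \<gamma>) (range (\<lambda>t. \<gamma> t + d *\<^sub>R q t))"
    using ambient_isotopic_perturbation[OF simple q] by blast
  \<comment> \<open>Halving keeps the closed interval up to \<open>b\<close>, on which continuity is
    required, strictly below both thresholds.\<close>
  define b where "b = min d0 d1 / 2"
  have b: "b > 0" "b < d0" "b < d1" using d0(1) d1(1) by (auto simp: b_def min_def)
  define g where "g = (\<lambda>d t. (cross3 (vderiv \<gamma> t + d *\<^sub>R vderiv q t) (vderiv (vderiv \<gamma>) t + d *\<^sub>R vderiv (vderiv q) t) \<bullet> w) /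
      (norm (squash w 0 (vderiv \<gamma> t + d *\<^sub>R vderiv q t)))\<^sup>2)"
  have bound: "kappa_tau K \<le> ereal (integral {0..1} (g d))" if "0 < d" "d < b" for d
    unfolding g_def using d0(2)[of d] d1(2)[of d] b that
    by (intro perturbed_lift_bound[OF \<gamma> q w]) auto
  have cont: "continuous_on ({0..b} \<times> {0..1}) (\<lambda>(d, t). g d t)"
  proof -
    \<comment> \<open>For d > 0 a vanishing projected velocity would make the planar determinant 0;
      at d = 0 the projection is immersed.\<close>
    have "squash w 0 (vderiv \<gamma> t + d *\<^sub>R vderiv q t) \<noteq> 0" if "d \<in> {0..b}" for d t
    proof (cases "d = 0")
      case False
      then have "cross3 (vderiv \<gamma> t + d *\<^sub>R vderiv q t) (vderiv (vderiv \<gamma>) t + d *\<^sub>R vderiv (vderiv q) t) \<bullet> w > 0"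
        using that b by (intro d1(2)) auto
      then show ?thesis
        unfolding squash_cross_inner[OF w, symmetric, of "vderiv \<gamma> t + d *\<^sub>R vderiv q t" _ 0]
        by auto
    qed (use nz in simp)
    then have nz': "perturbed_lift w (vderiv \<gamma>) (vderiv q) d 0 t \<noteq> 0" if "d \<in> {0..b}" for d t
      using that by (simp add: perturbed_lift_def)
    have g: "g d t = (cross3 (perturbed_lift w (vderiv \<gamma>) (vderiv q) d 0 t)
        (perturbed_lift w (vderiv (vderiv \<gamma>)) (vderiv (vderiv q)) d 0 t) \<bullet> w) /
        (norm (perturbed_lift w (vderiv \<gamma>) (vderiv q) d 0 t))\<^sup>2" for d t
      by (simp only: g_def perturbed_lift_def squash_cross_inner[OF w])
    show ?thesis
      unfolding split_beta g using nz'
      by (intro continuous_intros continuous_on_cross continuous_on_perturbed_lift smooth_curve_vderiv sm q(1))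
        auto
  qed
  have "kappa_tau K \<le> ereal (integral {0..1} (g 0))"
    by (rule parameter_limit[OF b(1) cont bound])
  then show ?thesis by (simp add: g_def W_def)
qed

lemma spiral_projection_turning_sign:
  assumes p: "regular_diagram p" "spiral_form p"
    and W: "\<And>t. W t = vderiv p t $ 1 * vderiv (vderiv p) t $ 2 - vderiv p t $ 2 * vderiv (vderiv p) t $ 1"
  shows "(\<forall>t. W t \<ge> 0) \<or> (\<forall>t. W t \<le> 0)"
    and "W t = 0 \<Longrightarrow> \<forall>\<^sub>F s in at t. W s \<noteq> 0"
proof -
  have sm: "smooth_curve p" and nz: "\<And>t. vderiv p t \<noteq> 0"
    and iso: "\<And>t. inflection p t \<Longrightarrow> \<forall>\<^sub>F s in at t. \<not> inflection p s"
    using p(1) by (auto simp: regular_diagram_def smooth_immersed_closed_curve_def)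
  have k: "signed_curvature p t = W t / norm (vderiv p t) ^ 3" for t
    unfolding W by (rule signed_curvature_eq[OF sm nz])
  have sgn: "signed_curvature p t = 0 \<longleftrightarrow> W t = 0" "signed_curvature p t > 0 \<longleftrightarrow> W t > 0"
    "signed_curvature p t < 0 \<longleftrightarrow> W t < 0" for t
    using nz[of t] by (simp_all add: k zero_less_divide_iff divide_less_0_iff)
  have isoW: "\<forall>\<^sub>F s in at t. W s \<noteq> 0" if "W t = 0" for t
    using iso[of t] that by (simp add: inflection_def sgn)
  then show "W t = 0 \<Longrightarrow> \<forall>\<^sub>F s in at t. W s \<noteq> 0" .
  have "continuous_on UNIV W"
    unfolding W[abs_def]
    by (intro continuous_intros smooth_curve_continuous smooth_curve_vderiv sm)
  then show "(\<forall>t. W t \<ge> 0) \<or> (\<forall>t. W t \<le> 0)"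
  proof (rule no_sign_change[OF _ isoW])
    fix t assume "W t = 0"
    then show "\<not> ((\<forall>\<^sub>F s in at_left t. W s < 0) \<and> (\<forall>\<^sub>F s in at_right t. W s > 0) \<or>
      (\<forall>\<^sub>F s in at_left t. W s > 0) \<and> (\<forall>\<^sub>F s in at_right t. W s < 0))"
      using p(2) by (simp add: spiral_form_def s_inflection_def inflection_def sgn)
  qed
qed

lemma kappa_tau_le_spiral_number:
  assumes \<gamma>: "conformation \<gamma> K" and p: "smooth_projection p \<gamma>" "spiral_form p"
  shows "kappa_tau K \<le> ereal (2 * pi * spiral_number p)"
proof -
  obtain u v where uv: "norm u = 1" "norm v = 1" "u \<bullet> v = 0" and p_def: "p = plane_projection u v \<gamma>"
    and reg: "regular_diagram p" using p(1) by (auto simp: smooth_projection_def)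
  have smp: "smooth_curve p" and perp: "\<And>t. p (t + 1) = p t" and nzp: "\<And>t. vderiv p t \<noteq> 0"
    using reg by (auto simp: regular_diagram_def smooth_immersed_closed_curve_def)
  have sm: "smooth_curve \<gamma>"
    using \<gamma> by (auto simp: conformation_def smooth_simple_closed_curve_def smooth_immersed_closed_curve_def)
  have "bounded_linear (\<lambda>x :: real^3. vector [x \<bullet> u, x \<bullet> v] :: real^2)"
    by (auto intro!: linear_conv_bounded_linear[THEN iffD1] linearI
        simp: vec_eq_iff forall_2 inner_add_left)
  from vderiv_bounded_linear[OF this]
  have "vderiv (\<lambda>t. vector [f t \<bullet> u, f t \<bullet> v] :: real^2) = (\<lambda>t. vector [vderiv f t \<bullet> u, vderiv f t \<bullet> v])"
    if "smooth_curve f" for f using that by blast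
  then have p': "vderiv p = (\<lambda>t. vector [vderiv \<gamma> t \<bullet> u, vderiv \<gamma> t \<bullet> v])"
    and p'': "vderiv (vderiv p) = (\<lambda>t. vector [vderiv (vderiv \<gamma>) t \<bullet> u, vderiv (vderiv \<gamma>) t \<bullet> v])"
    by (simp_all add: p_def plane_projection_def[abs_def] sm smooth_curve_vderiv)
  define W where "W = (\<lambda>t. vderiv p t $ 1 * vderiv (vderiv p) t $ 2 - vderiv p t $ 2 * vderiv (vderiv p) t $ 1)"
  define w0 where "w0 = cross3 u v"
  have W0: "W t = cross3 (vderiv \<gamma> t) (vderiv (vderiv \<gamma>) t) \<bullet> w0" for t
    by (simp add: W_def w0_def binet_cauchy fun_cong[OF p', of t] fun_cong[OF p'', of t])
  have "(norm w0)\<^sup>2 = 1\<^sup>2"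
    using norm_cross_dot[of u v] uv by (simp add: w0_def)
  then have w0: "norm w0 = 1" by (rule power2_eq_imp_eq) auto
  have Weq: "W t = vderiv p t $ 1 * vderiv (vderiv p) t $ 2 - vderiv p t $ 2 * vderiv (vderiv p) t $ 1" for t
    by (simp add: W_def)
  note sign = spiral_projection_turning_sign[OF reg p(2) Weq]
  \<comment> \<open>The normal is oriented to make the turning nonnegative; projected lengths
    involve only the square of the component along it.\<close>
  obtain w where w: "norm w = 1" "\<And>x. (x \<bullet> w)\<^sup>2 = (x \<bullet> w0)\<^sup>2"
    "\<And>t. \<bar>W t\<bar> = cross3 (vderiv \<gamma> t) (vderiv (vderiv \<gamma>) t) \<bullet> w"
  proof (cases "\<forall>t. W t \<ge> 0")
    case True
    then show ?thesis using that[of w0] w0 by (simp add: W0)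
  next
    case False
    then have "\<forall>t. W t \<le> 0" using sign(1) by blast
    then show ?thesis using that[of "- w0"] w0 by (simp add: W0)
  qed
  have norm_p': "(norm (squash w 0 (vderiv \<gamma> t)))\<^sup>2 = (norm (vderiv p t))\<^sup>2" for t
  proof -
    define x where "x = vderiv \<gamma> t"
    \<comment> \<open>The length of w0 \<times> x is that of the projection of x, and Lagrange's
      formula expresses this vector through the coordinates along u and v.\<close>
    have "cross3 w0 x = - ((x \<bullet> v) *\<^sub>R u - (x \<bullet> u) *\<^sub>R v)"
      unfolding w0_def using cross_skew[of "cross3 u v" x] Lagrange[of x u v] by simp
    then have "(norm (cross3 w0 x))\<^sup>2 = (norm ((x \<bullet> v) *\<^sub>R u - (x \<bullet> u) *\<^sub>R v))\<^sup>2"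
      by (simp only: norm_minus_cancel)
    also have "\<dots> = (x \<bullet> u)\<^sup>2 + (x \<bullet> v)\<^sup>2"
      using uv unfolding power2_norm_eq_inner norm_eq_1
      by (simp add: inner_diff_left inner_diff_right inner_commute power2_eq_square)
    also have "\<dots> = (norm (vderiv p t))\<^sup>2"
      unfolding power2_norm_eq_inner by (simp add: p' inner_vec_def sum_2 power2_eq_square x_def)
    finally have "(norm (vderiv p t))\<^sup>2 + (x \<bullet> w0)\<^sup>2 = (norm x)\<^sup>2"
      using norm_cross_dot[of w0 x] w0 by (simp add: inner_commute)
    then show ?thesis
      unfolding norm_squash_0[OF w(1)] w(2) x_def by linarith
  qed
  have "kappa_tau K \<le> ereal (integral {0..1} (\<lambda>t. \<bar>W t\<bar> / (norm (squash w 0 (vderiv \<gamma> t)))\<^sup>2))"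
  proof (rule kappa_tau_le_turning[OF \<gamma> w(1) w(3)])
    show "squash w 0 (vderiv \<gamma> t) \<noteq> 0" for t using norm_p'[of t] nzp[of t] by auto
    show "\<bar>W t\<bar> = 0 \<Longrightarrow> \<forall>\<^sub>F s in at t. \<bar>W s\<bar> \<noteq> 0" for t using sign(2)[of t] by simp
  qed simp
  also have "integral {0..1} (\<lambda>t. \<bar>W t\<bar> / (norm (squash w 0 (vderiv \<gamma> t)))\<^sup>2) = 2 * pi * spiral_number p"
    unfolding norm_p' by (rule spiral_number_eq_turning[OF smp perp nzp Weq sign])
  finally show ?thesis .
qed

theorem proposition4p5:
  fixes K :: "(real^3) set"
  assumes "knot K"
  shows "kappa_tau K \<le> ereal (2 * pi) * ereal_of_enat (spiral_index K)"
proof -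
  let ?S = "{enat (spiral_number p) | p \<gamma>. conformation \<gamma> K \<and> smooth_projection p \<gamma> \<and> spiral_form p}"
  show ?thesis
  proof (cases "?S = {}")
    case True
    then have "spiral_index K = \<infinity>" by (simp only: spiral_index_def Inf_enat_def) simp
    then show ?thesis by simp
  next
    case False
    then obtain k where "k \<in> ?S" by blast
    \<comment> \<open>The extended naturals are well-ordered, so the infimum is attained by an
      actual spiral projection.\<close>
    then have "spiral_index K \<in> ?S"
      unfolding spiral_index_def by (rule wellorder_InfI)
    then obtain p \<gamma> where "spiral_index K = enat (spiral_number p)"
      "conformation \<gamma> K" "smooth_projection p \<gamma>" "spiral_form p" by blast
    then show ?thesis using kappa_tau_le_spiral_number[of \<gamma> K p] by simp
  qed
qed

end
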